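(* Let $\mathbf A$ be a DG-category with shifts and cones, and let $\mathbf A^\natural$ be the DG-category of objects of $\mathbf A$ endowed with a contracting homotopy of zero square (defined in the context). Then there is a faithful additive functor $\Phi=\Phi_{\mathbf A}\colon \mathsf Z^0(\mathbf A)\to\mathsf Z^0(\mathbf A^\natural)$ given by the rule $A\mapsto\operatorname{cone}(\mathrm{id}_A[-1])$ (with the natural contracting homotopy) for all objects $A\in\mathbf A$. The functor $\Phi$ has faithful adjoint functors on both sides, with the left adjoint $\Psi^+\colon\mathsf Z^0(\mathbf A^\natural)\to\mathsf Z^0(\mathbf A)$ and the right adjoint $\Psi^-\colon\mathsf Z^0(\mathbf A^\natural)\to\mathsf Z^0(\mathbf A)$ given by $\Psi^+(X,\sigma_X)=X$ and $\Psi^-(X,\sigma_X)=X[1]$.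
   Context: Gradings: fix an abelian group $\Gamma$, a symmetric bilinear form $\sigma\colon\Gamma\times\Gamma\to\mathbb Z/2$ and an element $\mathbf 1\in\Gamma$ with $\sigma(\mathbf 1,\mathbf 1)=1$; complexes are $\Gamma$-graded with differentials of degree $\mathbf 1$ (an integer $n$ denotes the degree $n\cdot\mathbf 1$; $(-1)^i$ means $(-1)^{\sigma(\mathbf 1,i)}$), and signs follow the Koszul rule with $(-1)^{\sigma(a,b)}$ (standard case: $\Gamma=\mathbb Z$, $\sigma(a,b)=ab\bmod 2$). A DG-category $\mathbf A$ is a category enriched in complexes of abelian groups. $\mathsf Z^0(\mathbf A)$ is the preadditive category with the same objects whose morphisms are the degree-$0$ cocycles ("closed morphisms of degree $0$") in $\operatorname{Hom}^\bullet_{\mathbf A}(X,Y)$. Shift $X[i]$: an object with mutually inverse closed morphisms in $\operatorname{Hom}^{-i}_{\mathbf A}(X,X[i])$ and $\operatorname{Hom}^{i}_{\mathbf A}(X[i],X)$. The cone of a closed degree-$0$ morphism $f\colon X\to Y$ is an object $C$ with isomorphisms, functorial in $Z\in\mathbf A$, between $\operatorname{Hom}^\bullet_{\mathbf A}(Z,C)$ and the cone of $\operatorname{Hom}^\bullet_{\mathbf A}(Z,X)\to\operatorname{Hom}^\bullet_{\mathbf A}(Z,Y)$. "With shifts and cones" means all of these exist. The DG-category $\mathbf A^\natural$: objects are pairs $(X,\sigma_X)$ with $X\in\mathbf A$, $\sigma_X\in\operatorname{Hom}^{-1}_{\mathbf A}(X,X)$, $d(\sigma_X)=\mathrm{id}_X$,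 $\sigma_X^2=0$; $\operatorname{Hom}^i_{\mathbf A^\natural}((X,\sigma_X),(Y,\sigma_Y))$ is the group of closed morphisms $X\to Y$ of degree $-i$ in $\mathbf A$, with differential $d^\natural(f)=\sigma_Yf-(-1)^if\sigma_X$, and composition as in $\mathbf A$. The object $E=\operatorname{cone}(\mathrm{id}_A[-1])$ comes with closed morphisms $\iota\in\operatorname{Hom}^1(A,E)$, $\pi\in\operatorname{Hom}^0(E,A)$ and morphisms $\pi'\in\operatorname{Hom}^{-1}(E,A)$, $\iota'\in\operatorname{Hom}^0(A,E)$ such that $\pi'\iota'=0=\pi\iota$, $\pi'\iota=\mathrm{id}_A=\pi\iota'$, $\iota\pi'+\iota'\pi=\mathrm{id}_E$, $d(\pi')=\pi$, $d(\iota')=\iota$. Its natural contracting homotopy is $\sigma_E=\iota'\pi'$, so $\Phi(A)=(E,\sigma_E)$. *)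

theory Defs
  imports "HOL-Algebra.Chinese_Remainder" "HOL-Library.Z2"
begin

section \<open>Preadditive categories, functors, adjunctions\<close>

text \<open>
  Abelian groups are rendered as in HOL-Algebra, by the predicate \<^const>\<open>abelian_group\<close> on
  \<^typ>\<open>'m ring\<close>; the multiplicative fields of these records are never used.
  Every group of morphisms has its own carrier and addition, and every operation takes the objects
  (and degrees) it depends on as arguments, so that different groups of morphisms may overlap
  as sets.
\<close>

record ('o, 'm) precategory =
  Obj :: "'o set"
  Mor :: "'o \<Rightarrow> 'o \<Rightarrow> 'm ring"
  Comp :: "'o \<Rightarrow> 'o \<Rightarrow> 'o \<Rightarrow> 'm \<Rightarrow> 'm \<Rightarrow> 'm"  \<comment> \<open>\<open>Comp X Y Z g f\<close> is \<open>g f : X \<rightarrow> Y \<rightarrow> Z\<close>\<close>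
  Ident :: "'o \<Rightarrow> 'm"

locale preadditive_category =
  fixes C :: "('o, 'm) precategory"
  assumes Mor_group: "\<lbrakk>X \<in> Obj C; Y \<in> Obj C\<rbrakk> \<Longrightarrow> abelian_group (Mor C X Y)"
    and Ident_closed: "X \<in> Obj C \<Longrightarrow> Ident C X \<in> carrier (Mor C X X)"
    and Comp_closed: "\<lbrakk>X \<in> Obj C; Y \<in> Obj C; Z \<in> Obj C;
          g \<in> carrier (Mor C Y Z); f \<in> carrier (Mor C X Y)\<rbrakk>
        \<Longrightarrow> Comp C X Y Z g f \<in> carrier (Mor C X Z)"
    and Comp_add_left: "\<lbrakk>X \<in> Obj C; Y \<in> Obj C; Z \<in> Obj C;
          g \<in> carrier (Mor C Y Z); g' \<in> carrier (Mor C Y Z); f \<in> carrier (Mor C X Y)\<rbrakk>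
        \<Longrightarrow> Comp C X Y Z (g \<oplus>\<^bsub>Mor C Y Z\<^esub> g') f
            = Comp C X Y Z g f \<oplus>\<^bsub>Mor C X Z\<^esub> Comp C X Y Z g' f"
    and Comp_add_right: "\<lbrakk>X \<in> Obj C; Y \<in> Obj C; Z \<in> Obj C;
          g \<in> carrier (Mor C Y Z); f \<in> carrier (Mor C X Y); f' \<in> carrier (Mor C X Y)\<rbrakk>
        \<Longrightarrow> Comp C X Y Z g (f \<oplus>\<^bsub>Mor C X Y\<^esub> f')
            = Comp C X Y Z g f \<oplus>\<^bsub>Mor C X Z\<^esub> Comp C X Y Z g f'"
    and Comp_assoc: "\<lbrakk>W \<in> Obj C; X \<in> Obj C; Y \<in> Obj C; Z \<in> Obj C;
          h \<in> carrier (Mor C Y Z); g \<in> carrier (Mor C X Y); f \<in> carrier (Mor C W X)\<rbrakk>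
        \<Longrightarrow> Comp C W X Z (Comp C X Y Z h g) f = Comp C W Y Z h (Comp C W X Y g f)"
    and Ident_left: "\<lbrakk>X \<in> Obj C; Y \<in> Obj C; f \<in> carrier (Mor C X Y)\<rbrakk>
        \<Longrightarrow> Comp C X Y Y (Ident C Y) f = f"
    and Ident_right: "\<lbrakk>X \<in> Obj C; Y \<in> Obj C; f \<in> carrier (Mor C X Y)\<rbrakk>
        \<Longrightarrow> Comp C X X Y f (Ident C X) = f"

record ('o, 'm, 'p, 'n) functor_data =
  FOb :: "'o \<Rightarrow> 'p"
  FMor :: "'o \<Rightarrow> 'o \<Rightarrow> 'm \<Rightarrow> 'n"

locale category_functor =
  source: preadditive_category C + target: preadditive_category D
  for C :: "('o, 'm) precategory" and D :: "('p, 'n) precategory" +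
  fixes F :: "('o, 'm, 'p, 'n) functor_data"
  assumes FOb_closed: "X \<in> Obj C \<Longrightarrow> FOb F X \<in> Obj D"
    and FMor_closed: "\<lbrakk>X \<in> Obj C; Y \<in> Obj C; f \<in> carrier (Mor C X Y)\<rbrakk>
        \<Longrightarrow> FMor F X Y f \<in> carrier (Mor D (FOb F X) (FOb F Y))"
    and FMor_Ident: "X \<in> Obj C \<Longrightarrow> FMor F X X (Ident C X) = Ident D (FOb F X)"
    and FMor_Comp: "\<lbrakk>X \<in> Obj C; Y \<in> Obj C; Z \<in> Obj C;
          g \<in> carrier (Mor C Y Z); f \<in> carrier (Mor C X Y)\<rbrakk>
        \<Longrightarrow> FMor F X Z (Comp C X Y Z g f)
            = Comp D (FOb F X) (FOb F Y) (FOb F Z) (FMor F Y Z g) (FMor F X Y f)"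

locale additive_functor = category_functor C D F
  for C :: "('o, 'm) precategory" and D :: "('p, 'n) precategory"
    and F :: "('o, 'm, 'p, 'n) functor_data" +
  assumes FMor_add: "\<lbrakk>X \<in> Obj C; Y \<in> Obj C; f \<in> carrier (Mor C X Y); g \<in> carrier (Mor C X Y)\<rbrakk>
        \<Longrightarrow> FMor F X Y (f \<oplus>\<^bsub>Mor C X Y\<^esub> g)
            = FMor F X Y f \<oplus>\<^bsub>Mor D (FOb F X) (FOb F Y)\<^esub> FMor F X Y g"

definition faithful :: "('o, 'm) precategory \<Rightarrow> ('o, 'm, 'p, 'n) functor_data \<Rightarrow> bool" where
  "faithful C F \<longleftrightarrow> (\<forall>X\<in>Obj C. \<forall>Y\<in>Obj C. inj_on (FMor F X Y) (carrier (Mor C X Y)))"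

text \<open>\<open>F : C \<rightarrow> D\<close> is left adjoint to \<open>G : D \<rightarrow> C\<close>.\<close>

definition left_adjoint ::
  "('o, 'm) precategory \<Rightarrow> ('p, 'n) precategory
    \<Rightarrow> ('o, 'm, 'p, 'n) functor_data \<Rightarrow> ('p, 'n, 'o, 'm) functor_data \<Rightarrow> bool" where
  "left_adjoint C D F G \<longleftrightarrow>
     category_functor C D F \<and> category_functor D C G \<and>
     (\<exists>\<theta>. (\<forall>X\<in>Obj C. \<forall>Y\<in>Obj D.
              bij_betw (\<theta> X Y) (carrier (Mor D (FOb F X) Y)) (carrier (Mor C X (FOb G Y)))) \<and>
          (\<forall>X\<in>Obj C. \<forall>X'\<in>Obj C. \<forall>Y\<in>Obj D.
             \<forall>a\<in>carrier (Mor C X' X). \<forall>g\<in>carrier (Mor D (FOb F X) Y).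
              \<theta> X' Y (Comp D (FOb F X') (FOb F X) Y g (FMor F X' X a))
                = Comp C X' X (FOb G Y) (\<theta> X Y g) a) \<and>
          (\<forall>X\<in>Obj C. \<forall>Y\<in>Obj D. \<forall>Y'\<in>Obj D.
             \<forall>b\<in>carrier (Mor D Y Y'). \<forall>g\<in>carrier (Mor D (FOb F X) Y).
              \<theta> X Y' (Comp D (FOb F X) Y Y' b g)
                = Comp C X (FOb G Y) (FOb G Y') (FMor G Y Y' b) (\<theta> X Y g)))"


section \<open>Graded complexes\<close>

record 'g grading =
  pairing :: "'g \<Rightarrow> 'g \<Rightarrow> bit"
  unit_deg :: "'g"

locale grading =
  fixes \<Gamma> :: "('g::ab_group_add, 'x) grading_scheme"
  assumes pairing_add: "pairing \<Gamma> (a + b) c = pairing \<Gamma> a c + pairing \<Gamma> b c"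
    and pairing_sym: "pairing \<Gamma> a b = pairing \<Gamma> b a"
    and pairing_unit: "pairing \<Gamma> (unit_deg \<Gamma>) (unit_deg \<Gamma>) = 1"

text \<open>\<open>ksign G b x\<close> is the element \<open>(-1)\<^sup>b x\<close> of the abelian group \<open>G\<close>.\<close>

definition ksign :: "'m ring \<Rightarrow> bit \<Rightarrow> 'm \<Rightarrow> 'm" where
  "ksign G b x = (if b = 0 then x else \<ominus>\<^bsub>G\<^esub> x)"

record ('m, 'g) gcomplex =
  grp :: "'g \<Rightarrow> 'm ring"
  diff :: "'g \<Rightarrow> 'm \<Rightarrow> 'm"  \<comment> \<open>\<open>diff K i\<close> is the differential out of degree \<open>i\<close>\<close>

definition is_complex :: "('g::ab_group_add, 'x) grading_scheme \<Rightarrow> ('m, 'g) gcomplex \<Rightarrow> bool" where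
  "is_complex \<Gamma> K \<longleftrightarrow>
     (\<forall>i. abelian_group (grp K i)) \<and>
     (\<forall>i. diff K i \<in> hom (add_monoid (grp K i)) (add_monoid (grp K (i + unit_deg \<Gamma>)))) \<and>
     (\<forall>i. \<forall>x\<in>carrier (grp K i).
        diff K (i + unit_deg \<Gamma>) (diff K i x) = \<zero>\<^bsub>grp K (i + unit_deg \<Gamma> + unit_deg \<Gamma>)\<^esub>)"

text \<open>The group of degree \<open>i\<close> cocycles.\<close>

definition cocycles ::
  "('g::ab_group_add, 'x) grading_scheme \<Rightarrow> ('m, 'g) gcomplex \<Rightarrow> 'g \<Rightarrow> 'm ring" where
  "cocycles \<Gamma> K i =
     (grp K i)\<lparr>carrier := {x \<in> carrier (grp K i). diff K i x = \<zero>\<^bsub>grp K (i + unit_deg \<Gamma>)\<^esub>}\<rparr>"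

text \<open>
  The cone of a chain map \<open>f : K \<rightarrow> L\<close> is \<open>K[1] \<oplus> L\<close>, with differential
  \<open>(k, l) \<mapsto> (- d k, f k + d l)\<close>.
\<close>

definition cone_complex ::
  "('g::ab_group_add, 'x) grading_scheme \<Rightarrow> ('m, 'g) gcomplex \<Rightarrow> ('m, 'g) gcomplex
    \<Rightarrow> ('g \<Rightarrow> 'm \<Rightarrow> 'm) \<Rightarrow> ('m \<times> 'm, 'g) gcomplex" where
  "cone_complex \<Gamma> K L f =
     \<lparr>grp = (\<lambda>i. RDirProd (grp K (i + unit_deg \<Gamma>)) (grp L i)),
      diff = (\<lambda>i (k, l).
        (\<ominus>\<^bsub>grp K (i + unit_deg \<Gamma> + unit_deg \<Gamma>)\<^esub> diff K (i + unit_deg \<Gamma>) k,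
         f (i + unit_deg \<Gamma>) k \<oplus>\<^bsub>grp L (i + unit_deg \<Gamma>)\<^esub> diff L i l))\<rparr>"

definition complex_iso ::
  "('g::ab_group_add, 'x) grading_scheme \<Rightarrow> ('m, 'g) gcomplex \<Rightarrow> ('n, 'g) gcomplex
    \<Rightarrow> ('g \<Rightarrow> 'm \<Rightarrow> 'n) \<Rightarrow> bool" where
  "complex_iso \<Gamma> K L \<phi> \<longleftrightarrow>
     (\<forall>i. \<phi> i \<in> iso (add_monoid (grp K i)) (add_monoid (grp L i))) \<and>
     (\<forall>i. \<forall>x\<in>carrier (grp K i). \<phi> (i + unit_deg \<Gamma>) (diff K i x) = diff L i (\<phi> i x))"


section \<open>DG-categories\<close>

record ('o, 'm, 'g) dgcat = "'g grading" +
  Ob :: "'o set"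
  Hom :: "'o \<Rightarrow> 'o \<Rightarrow> ('m, 'g) gcomplex"
  Cmp :: "'o \<Rightarrow> 'o \<Rightarrow> 'o \<Rightarrow> 'g \<Rightarrow> 'g \<Rightarrow> 'm \<Rightarrow> 'm \<Rightarrow> 'm"
    \<comment> \<open>\<open>Cmp X Y Z i j g f\<close> is \<open>g f\<close> for \<open>g \<in> Hom\<^sup>i(Y, Z)\<close> and \<open>f \<in> Hom\<^sup>j(X, Y)\<close>\<close>
  Idn :: "'o \<Rightarrow> 'm"

locale dg_category = grading A
  for A :: "('o, 'm, 'g::ab_group_add) dgcat" +
  assumes Hom_complex: "\<lbrakk>X \<in> Ob A; Y \<in> Ob A\<rbrakk> \<Longrightarrow> is_complex A (Hom A X Y)"
    and Idn_closed: "X \<in> Ob A \<Longrightarrow> Idn A X \<in> carrier (cocycles A (Hom A X X) 0)"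
    and Cmp_closed: "\<lbrakk>X \<in> Ob A; Y \<in> Ob A; Z \<in> Ob A;
          g \<in> carrier (grp (Hom A Y Z) i); f \<in> carrier (grp (Hom A X Y) j)\<rbrakk>
        \<Longrightarrow> Cmp A X Y Z i j g f \<in> carrier (grp (Hom A X Z) (i + j))"
    and Cmp_add_left: "\<lbrakk>X \<in> Ob A; Y \<in> Ob A; Z \<in> Ob A; g \<in> carrier (grp (Hom A Y Z) i);
          g' \<in> carrier (grp (Hom A Y Z) i); f \<in> carrier (grp (Hom A X Y) j)\<rbrakk>
        \<Longrightarrow> Cmp A X Y Z i j (g \<oplus>\<^bsub>grp (Hom A Y Z) i\<^esub> g') f
            = Cmp A X Y Z i j g f \<oplus>\<^bsub>grp (Hom A X Z) (i + j)\<^esub> Cmp A X Y Z i j g' f"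
    and Cmp_add_right: "\<lbrakk>X \<in> Ob A; Y \<in> Ob A; Z \<in> Ob A; g \<in> carrier (grp (Hom A Y Z) i);
          f \<in> carrier (grp (Hom A X Y) j); f' \<in> carrier (grp (Hom A X Y) j)\<rbrakk>
        \<Longrightarrow> Cmp A X Y Z i j g (f \<oplus>\<^bsub>grp (Hom A X Y) j\<^esub> f')
            = Cmp A X Y Z i j g f \<oplus>\<^bsub>grp (Hom A X Z) (i + j)\<^esub> Cmp A X Y Z i j g f'"
    and Cmp_diff: "\<lbrakk>X \<in> Ob A; Y \<in> Ob A; Z \<in> Ob A;
          g \<in> carrier (grp (Hom A Y Z) i); f \<in> carrier (grp (Hom A X Y) j)\<rbrakk>
        \<Longrightarrow> diff (Hom A X Z) (i + j) (Cmp A X Y Z i j g f)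
            = Cmp A X Y Z (i + unit_deg A) j (diff (Hom A Y Z) i g) f
              \<oplus>\<^bsub>grp (Hom A X Z) (i + j + unit_deg A)\<^esub>
              ksign (grp (Hom A X Z) (i + j + unit_deg A)) (pairing A (unit_deg A) i)
                (Cmp A X Y Z i (j + unit_deg A) g (diff (Hom A X Y) j f))"
    and Cmp_assoc: "\<lbrakk>W \<in> Ob A; X \<in> Ob A; Y \<in> Ob A; Z \<in> Ob A; h \<in> carrier (grp (Hom A Y Z) i);
          g \<in> carrier (grp (Hom A X Y) j); f \<in> carrier (grp (Hom A W X) k)\<rbrakk>
        \<Longrightarrow> Cmp A W X Z (i + j) k (Cmp A X Y Z i j h g) f
            = Cmp A W Y Z i (j + k) h (Cmp A W X Y j k g f)"
    and Idn_left: "\<lbrakk>X \<in> Ob A; Y \<in> Ob A; f \<in> carrier (grp (Hom A X Y) i)\<rbrakk>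
        \<Longrightarrow> Cmp A X Y Y 0 i (Idn A Y) f = f"
    and Idn_right: "\<lbrakk>X \<in> Ob A; Y \<in> Ob A; f \<in> carrier (grp (Hom A X Y) i)\<rbrakk>
        \<Longrightarrow> Cmp A X X Y i 0 f (Idn A X) = f"

definition Z0 :: "('o, 'm, 'g::ab_group_add) dgcat \<Rightarrow> ('o, 'm) precategory" where
  "Z0 A = \<lparr>Obj = Ob A, Mor = (\<lambda>X Y. cocycles A (Hom A X Y) 0),
           Comp = (\<lambda>X Y Z. Cmp A X Y Z 0 0), Ident = Idn A\<rparr>"


section \<open>Shifts and cones\<close>

record ('o, 'm) shift =
  sh_obj :: 'o   \<comment> \<open>\<open>X[i]\<close>\<close>
  sh_in :: 'm    \<comment> \<open>the closed morphism \<open>X \<rightarrow> X[i]\<close> of degree \<open>-i\<close>\<close>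
  sh_out :: 'm   \<comment> \<open>the closed morphism \<open>X[i] \<rightarrow> X\<close> of degree \<open>i\<close>\<close>

definition is_shift ::
  "('o, 'm, 'g::ab_group_add) dgcat \<Rightarrow> 'o \<Rightarrow> 'g \<Rightarrow> ('o, 'm) shift \<Rightarrow> bool" where
  "is_shift A X i S \<longleftrightarrow>
     sh_obj S \<in> Ob A \<and>
     sh_in S \<in> carrier (cocycles A (Hom A X (sh_obj S)) (- i)) \<and>
     sh_out S \<in> carrier (cocycles A (Hom A (sh_obj S) X) i) \<and>
     Cmp A X (sh_obj S) X i (- i) (sh_out S) (sh_in S) = Idn A X \<and>
     Cmp A (sh_obj S) X (sh_obj S) (- i) i (sh_in S) (sh_out S) = Idn A (sh_obj S)"

record ('o, 'm, 'g) cone =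
  cn_obj :: 'o
  cn_iso :: "'o \<Rightarrow> 'g \<Rightarrow> 'm \<Rightarrow> 'm \<times> 'm"

text \<open>
  \<open>C\<close> is a cone of the closed degree \<open>0\<close> morphism \<open>f : X \<rightarrow> Y\<close>, through isomorphisms
  \<open>cn_iso C Z\<close> from \<open>Hom(Z, C)\<close> to the cone of \<open>Hom(Z, X) \<rightarrow> Hom(Z, Y)\<close>. Functoriality in \<open>Z\<close> is
  with respect to homogeneous morphisms \<open>a : Z' \<rightarrow> Z\<close> of every degree \<open>j\<close>; since the shift in
  \<open>K[1] \<oplus> L\<close> is on the left and \<open>a\<close> acts on the right, the action of \<open>a\<close> involves no sign.
\<close>

definition is_cone ::
  "('o, 'm, 'g::ab_group_add) dgcat \<Rightarrow> 'o \<Rightarrow> 'o \<Rightarrow> 'm \<Rightarrow> ('o, 'm, 'g) cone \<Rightarrow> bool" where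
  "is_cone A X Y f C \<longleftrightarrow>
     cn_obj C \<in> Ob A \<and>
     (\<forall>Z\<in>Ob A. complex_iso A (Hom A Z (cn_obj C))
        (cone_complex A (Hom A Z X) (Hom A Z Y) (\<lambda>i. Cmp A Z X Y 0 i f)) (cn_iso C Z)) \<and>
     (\<forall>Z\<in>Ob A. \<forall>Z'\<in>Ob A. \<forall>i j. \<forall>h\<in>carrier (grp (Hom A Z (cn_obj C)) i).
        \<forall>a\<in>carrier (grp (Hom A Z' Z) j).
          cn_iso C Z' (i + j) (Cmp A Z' Z (cn_obj C) i j h a) =
            (Cmp A Z' Z X (i + unit_deg A) j (fst (cn_iso C Z i h)) a,
             Cmp A Z' Z Y i j (snd (cn_iso C Z i h)) a))"

definition has_shifts :: "('o, 'm, 'g::ab_group_add) dgcat \<Rightarrow> bool" where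
  "has_shifts A \<longleftrightarrow> (\<forall>X\<in>Ob A. \<forall>i. \<exists>S. is_shift A X i S)"

definition has_cones :: "('o, 'm, 'g::ab_group_add) dgcat \<Rightarrow> bool" where
  "has_cones A \<longleftrightarrow> (\<forall>X\<in>Ob A. \<forall>Y\<in>Ob A. \<forall>f\<in>carrier (cocycles A (Hom A X Y) 0).
     \<exists>C. is_cone A X Y f C)"

text \<open>
  The structure morphisms of a cone, obtained from the representing isomorphisms: the identity of
  \<open>C\<close> corresponds to the pair of projections \<open>(C \<rightarrow> X of degree 1, C \<rightarrow> Y of degree 0)\<close>, while the
  injections \<open>X \<rightarrow> C\<close> of degree \<open>-1\<close> and \<open>Y \<rightarrow> C\<close> of degree \<open>0\<close> correspond to \<open>(id, 0)\<close> and
  \<open>(0, id)\<close>.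
\<close>

definition cone_proj1 :: "('o, 'm, 'g::ab_group_add) dgcat \<Rightarrow> ('o, 'm, 'g) cone \<Rightarrow> 'm" where
  "cone_proj1 A C = fst (cn_iso C (cn_obj C) 0 (Idn A (cn_obj C)))"

definition cone_proj2 :: "('o, 'm, 'g::ab_group_add) dgcat \<Rightarrow> ('o, 'm, 'g) cone \<Rightarrow> 'm" where
  "cone_proj2 A C = snd (cn_iso C (cn_obj C) 0 (Idn A (cn_obj C)))"

definition cone_inj1 ::
  "('o, 'm, 'g::ab_group_add) dgcat \<Rightarrow> 'o \<Rightarrow> 'o \<Rightarrow> ('o, 'm, 'g) cone \<Rightarrow> 'm" where
  "cone_inj1 A X Y C =
     inv_into (carrier (grp (Hom A X (cn_obj C)) (- unit_deg A))) (cn_iso C X (- unit_deg A))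
       (Idn A X, \<zero>\<^bsub>grp (Hom A X Y) (- unit_deg A)\<^esub>)"

definition cone_inj2 ::
  "('o, 'm, 'g::ab_group_add) dgcat \<Rightarrow> 'o \<Rightarrow> 'o \<Rightarrow> ('o, 'm, 'g) cone \<Rightarrow> 'm" where
  "cone_inj2 A X Y C =
     inv_into (carrier (grp (Hom A Y (cn_obj C)) 0)) (cn_iso C Y 0)
       (\<zero>\<^bsub>grp (Hom A Y X) (unit_deg A)\<^esub>, Idn A Y)"


section \<open>The DG-category of objects with a contracting homotopy of zero square\<close>

definition dg_natural :: "('o, 'm, 'g::ab_group_add) dgcat \<Rightarrow> ('o \<times> 'm, 'm, 'g) dgcat" where
  "dg_natural A =
     \<lparr>pairing = pairing A, unit_deg = unit_deg A,
      Ob = {(X, s). X \<in> Ob A \<and> s \<in> carrier (grp (Hom A X X) (- unit_deg A)) \<and>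
              diff (Hom A X X) (- unit_deg A) s = Idn A X \<and>
              Cmp A X X X (- unit_deg A) (- unit_deg A) s s
                = \<zero>\<^bsub>grp (Hom A X X) (- unit_deg A + - unit_deg A)\<^esub>},
      Hom = (\<lambda>(X, s) (Y, t).
        \<lparr>grp = (\<lambda>i. cocycles A (Hom A X Y) (- i)),
         diff = (\<lambda>i f.
           Cmp A X Y Y (- unit_deg A) (- i) t f
             \<ominus>\<^bsub>grp (Hom A X Y) (- (i + unit_deg A))\<^esub>
           ksign (grp (Hom A X Y) (- (i + unit_deg A))) (pairing A (unit_deg A) i)
             (Cmp A X X Y (- i) (- unit_deg A) f s))\<rparr>),
      Cmp = (\<lambda>(X, s) (Y, t) (Z, r) i j. Cmp A X Y Z (- i) (- j)),
      Idn = (\<lambda>(X, s). Idn A X)\<rparr>"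


section \<open>The cone of the identity of \<open>A[-1]\<close>\<close>

text \<open>
  For an object \<open>X\<close> with a shift \<open>S = X[-1]\<close> and a cone \<open>E\<close> of the identity of \<open>X[-1]\<close>, composing
  the structure morphisms of the cone with those of the shift gives
  \<open>\<iota> \<in> Hom\<^sup>1(X, E)\<close>, \<open>\<iota>' \<in> Hom\<^sup>0(X, E)\<close>, \<open>\<pi> \<in> Hom\<^sup>0(E, X)\<close>, \<open>\<pi>' \<in> Hom\<^sup>-\<^sup>1(E, X)\<close> with
  \<open>d \<iota> = 0\<close>, \<open>d \<pi> = 0\<close>, \<open>d \<iota>' = \<iota>\<close>, \<open>d \<pi>' = \<pi>\<close>, \<open>\<pi>' \<iota>' = 0 = \<pi> \<iota>\<close>, \<open>\<pi>' \<iota> = id = \<pi> \<iota>'\<close> and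
  \<open>\<iota> \<pi>' + \<iota>' \<pi> = id\<close>.
\<close>

definition E_iota ::
  "('o, 'm, 'g::ab_group_add) dgcat \<Rightarrow> 'o \<Rightarrow> ('o, 'm) shift \<Rightarrow> ('o, 'm, 'g) cone \<Rightarrow> 'm" where
  "E_iota A X S E =
     Cmp A X (sh_obj S) (cn_obj E) 0 (unit_deg A) (cone_inj2 A (sh_obj S) (sh_obj S) E) (sh_in S)"

definition E_iota' ::
  "('o, 'm, 'g::ab_group_add) dgcat \<Rightarrow> 'o \<Rightarrow> ('o, 'm) shift \<Rightarrow> ('o, 'm, 'g) cone \<Rightarrow> 'm" where
  "E_iota' A X S E =
     Cmp A X (sh_obj S) (cn_obj E) (- unit_deg A) (unit_deg A)
       (cone_inj1 A (sh_obj S) (sh_obj S) E) (sh_in S)"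

definition E_pi ::
  "('o, 'm, 'g::ab_group_add) dgcat \<Rightarrow> 'o \<Rightarrow> ('o, 'm) shift \<Rightarrow> ('o, 'm, 'g) cone \<Rightarrow> 'm" where
  "E_pi A X S E =
     Cmp A (cn_obj E) (sh_obj S) X (- unit_deg A) (unit_deg A) (sh_out S) (cone_proj1 A E)"

definition E_pi' ::
  "('o, 'm, 'g::ab_group_add) dgcat \<Rightarrow> 'o \<Rightarrow> ('o, 'm) shift \<Rightarrow> ('o, 'm, 'g) cone \<Rightarrow> 'm" where
  "E_pi' A X S E =
     Cmp A (cn_obj E) (sh_obj S) X (- unit_deg A) 0 (sh_out S) (cone_proj2 A E)"

text \<open>The natural contracting homotopy \<open>\<iota>' \<pi>'\<close> of \<open>E\<close>.\<close>

definition E_sigma ::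
  "('o, 'm, 'g::ab_group_add) dgcat \<Rightarrow> 'o \<Rightarrow> ('o, 'm) shift \<Rightarrow> ('o, 'm, 'g) cone \<Rightarrow> 'm" where
  "E_sigma A X S E =
     Cmp A (cn_obj E) X (cn_obj E) 0 (- unit_deg A) (E_iota' A X S E) (E_pi' A X S E)"

text \<open>
  The morphism \<open>\<iota> f \<pi>' + \<iota>' f \<pi>\<close> induced by a closed degree \<open>0\<close> morphism \<open>f : X \<rightarrow> Y\<close> on the cones
  \<open>E\<close> and \<open>E'\<close> of the identities of \<open>X[-1]\<close> and \<open>Y[-1]\<close>.
\<close>

definition E_map ::
  "('o, 'm, 'g::ab_group_add) dgcat \<Rightarrow> 'o \<Rightarrow> ('o, 'm) shift \<Rightarrow> ('o, 'm, 'g) cone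
    \<Rightarrow> 'o \<Rightarrow> ('o, 'm) shift \<Rightarrow> ('o, 'm, 'g) cone \<Rightarrow> 'm \<Rightarrow> 'm" where
  "E_map A X S E Y S' E' f =
     Cmp A (cn_obj E) Y (cn_obj E') (unit_deg A) (- unit_deg A) (E_iota A Y S' E')
         (Cmp A (cn_obj E) X Y 0 (- unit_deg A) f (E_pi' A X S E))
       \<oplus>\<^bsub>grp (Hom A (cn_obj E) (cn_obj E')) 0\<^esub>
     Cmp A (cn_obj E) Y (cn_obj E') 0 0 (E_iota' A Y S' E')
         (Cmp A (cn_obj E) X Y 0 0 f (E_pi A X S E))"

text \<open>The morphism \<open>X[i] \<rightarrow> Y[i]\<close> induced by \<open>f : X \<rightarrow> Y\<close> of degree \<open>0\<close>.\<close>

definition shift_map ::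
  "('o, 'm, 'g::ab_group_add) dgcat \<Rightarrow> 'g \<Rightarrow> 'o \<Rightarrow> ('o, 'm) shift \<Rightarrow> 'o \<Rightarrow> ('o, 'm) shift \<Rightarrow> 'm \<Rightarrow> 'm"
  where
  "shift_map A i X S Y S' f =
     Cmp A (sh_obj S) Y (sh_obj S') (- i) i (sh_in S')
       (Cmp A (sh_obj S) X Y 0 i f (sh_out S))"

end

theory Submission
  imports Defs
begin

text \<open>
  Nothing about the cone \<open>E\<close> of the identity of \<open>X[-1]\<close> matters beyond the relations between its
  structure morphisms \<open>\<iota>, \<iota>' : X \<rightarrow> E\<close> and \<open>\<pi>, \<pi>' : E \<rightarrow> X\<close>: as a graded object, \<open>E\<close> is the biproduct of
  \<open>X\<close> and a shift of \<open>X\<close>, since \<open>\<iota> \<pi>' + \<iota>' \<pi> = id\<close>, \<open>\<pi>' \<iota> = id = \<pi> \<iota>'\<close> and \<open>\<pi>' \<iota>' = 0 = \<pi> \<iota>\<close>, and its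
  differential is recorded by \<open>d \<iota>' = \<iota>\<close>, \<open>d \<pi>' = \<pi>\<close>. Call such an object a disk on \<open>X\<close>. The proof has
  two independent halves: cones of identities are disks, and disks give the functors.

  For the first half, the isomorphism between \<open>Hom(Z, C)\<close> and the cone of \<open>Hom(Z, X) \<rightarrow> Hom(Z, Y)\<close> is,
  by functoriality, composition with the two projections \<open>p\<close> and \<open>q\<close> of \<open>C\<close>. So a morphism into \<open>C\<close> is
  determined by its composites with \<open>p\<close> and \<open>q\<close> (\<open>cone_eqI\<close>), and its differential is given by the
  differential of the cone complex (\<open>cn_iso_d\<close>). All identities between \<open>p\<close>, \<open>q\<close> and the two injections
  follow, and composing with the isomorphisms between \<open>X\<close> and \<open>X[-1]\<close> yields a disk
  (\<open>disk_of_cone\<close>). The minus sign in \<open>d q = - f p\<close> is cancelled by the one that the Leibniz rule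
  produces when \<open>q\<close> is composed with a closed morphism of degree \<open>-1\<close>.

  For the second half, a closed \<open>f : X \<rightarrow> Y\<close> acts on disks by \<open>\<iota> f \<pi>' + \<iota>' f \<pi>\<close>. This is functorial and
  additive by the relations, and \<open>f\<close> is recovered as \<open>\<pi> (\<iota> f \<pi>' + \<iota>' f \<pi>) \<iota>'\<close>, whence faithfulness.
  The homotopy of the disk is \<open>\<iota>' \<pi>'\<close>. Hence a closed \<open>h : X \<rightarrow> E(Y)\<close> commutes with the
  homotopies exactly if \<open>\<iota>' \<pi>' h = h s\<close>; then \<open>\<pi>' h = \<pi> h s\<close>, so that \<open>h\<close> is determined by \<open>\<pi> h : X \<rightarrow> Y\<close>,
  which can be an arbitrary closed morphism (\<open>\<Psi>p_adjoint_bij\<close>). Dually, a morphism \<open>h : E(X) \<rightarrow> Y\<close> with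
  \<open>t h = h \<iota>' \<pi>'\<close> satisfies \<open>h \<iota>' = t h \<iota>\<close> and is determined by the arbitrary closed morphism
  \<open>h \<iota> : X \<rightarrow> Y\<close> of degree \<open>1\<close>, which is the same as a closed morphism \<open>X \<rightarrow> Y[1]\<close> of degree \<open>0\<close>
  (\<open>\<Psi>m_adjoint_bij\<close>).
\<close>

section \<open>Adjunctions and subgroups\<close>

text \<open>
  The inverses of a natural family of bijections are natural. This allows an adjunction to be given
  in whichever direction the bijection has the simpler formula; for \<open>\<Psi>\<^sup>+\<close> and \<open>\<Phi>\<close> it is composition
  with \<open>\<pi>\<close>.
\<close>

lemma left_adjoint_by_inverse:
  fixes \<rho> :: "'o \<Rightarrow> 'p \<Rightarrow> 'm \<Rightarrow> 'n"
  assumes F: "category_functor C D F" and G: "category_functor D C G"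
    and bij: "\<And>X Y. \<lbrakk>X \<in> Obj C; Y \<in> Obj D\<rbrakk> \<Longrightarrow>
        bij_betw (\<rho> X Y) (carrier (Mor C X (FOb G Y))) (carrier (Mor D (FOb F X) Y))"
    and nat_source: "\<And>X X' Y a h. \<lbrakk>X \<in> Obj C; X' \<in> Obj C; Y \<in> Obj D;
        a \<in> carrier (Mor C X' X); h \<in> carrier (Mor C X (FOb G Y))\<rbrakk> \<Longrightarrow>
        \<rho> X' Y (Comp C X' X (FOb G Y) h a) = Comp D (FOb F X') (FOb F X) Y (\<rho> X Y h) (FMor F X' X a)"
    and nat_target: "\<And>X Y Y' b h. \<lbrakk>X \<in> Obj C; Y \<in> Obj D; Y' \<in> Obj D;
        b \<in> carrier (Mor D Y Y'); h \<in> carrier (Mor C X (FOb G Y))\<rbrakk> \<Longrightarrow>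
        \<rho> X Y' (Comp C X (FOb G Y) (FOb G Y') (FMor G Y Y' b) h) = Comp D (FOb F X) Y Y' b (\<rho> X Y h)"
  shows "left_adjoint C D F G"
proof -
  interpret F: category_functor C D F by (rule F)
  interpret G: category_functor D C G by (rule G)
  define \<theta> where "\<theta> X Y = inv_into (carrier (Mor C X (FOb G Y))) (\<rho> X Y)" for X Y
  have \<theta>_bij: "bij_betw (\<theta> X Y) (carrier (Mor D (FOb F X) Y)) (carrier (Mor C X (FOb G Y)))"
    if "X \<in> Obj C" "Y \<in> Obj D" for X Y
    unfolding \<theta>_def by (rule bij_betw_inv_into[OF bij[OF that]])
  have \<theta>_eq: "\<theta> X Y g = h"
    if "X \<in> Obj C" "Y \<in> Obj D" "h \<in> carrier (Mor C X (FOb G Y))" "\<rho> X Y h = g" for X Y g h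
    unfolding \<theta>_def using bij_betw_inv_into_left[OF bij[OF that(1,2)] that(3)] that(4) by simp
  have \<theta>_mem: "\<theta> X Y g \<in> carrier (Mor C X (FOb G Y))" and \<rho>_\<theta>: "\<rho> X Y (\<theta> X Y g) = g"
    if "X \<in> Obj C" "Y \<in> Obj D" "g \<in> carrier (Mor D (FOb F X) Y)" for X Y g
    using bij_betwE[OF \<theta>_bij[OF that(1,2)]] bij_betw_inv_into_right[OF bij[OF that(1,2)] that(3)] that(3)
    by (auto simp: \<theta>_def)
  show ?thesis
    unfolding left_adjoint_def
    using F G
    by (intro conjI exI[of _ \<theta>] ballI)
       (auto intro!: \<theta>_bij \<theta>_eq F.source.Comp_closed G.FMor_closed
         simp: nat_source nat_target \<rho>_\<theta> \<theta>_mem G.FOb_closed)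
qed

lemma abelian_group_subgroup:
  assumes "abelian_group G" "H \<subseteq> carrier G" "\<zero>\<^bsub>G\<^esub> \<in> H"
    and "\<And>x y. x \<in> H \<Longrightarrow> y \<in> H \<Longrightarrow> x \<oplus>\<^bsub>G\<^esub> y \<in> H"
    and "\<And>x. x \<in> H \<Longrightarrow> \<ominus>\<^bsub>G\<^esub> x \<in> H"
  shows "abelian_group (G\<lparr>carrier := H\<rparr>)"
proof -
  interpret abelian_group G by fact
  show ?thesis
    using assms(2-)
    by (intro abelian_groupI)
       (auto simp: subset_iff intro: a_assoc a_comm, metis l_neg)
qed

section \<open>Homogeneous morphisms\<close>

context dg_category
begin

abbreviation u :: 'g where "u \<equiv> unit_deg A"
abbreviation G :: "'o \<Rightarrow> 'o \<Rightarrow> 'g \<Rightarrow> 'm ring" where "G X Y i \<equiv> grp (Hom A X Y) i"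
abbreviation d :: "'o \<Rightarrow> 'o \<Rightarrow> 'g \<Rightarrow> 'm \<Rightarrow> 'm" where "d X Y i \<equiv> diff (Hom A X Y) i"

lemma pairing_unit_0 [simp]: "pairing A u 0 = 0"
  using pairing_add[of 0 0 u] pairing_sym[of u 0] by simp

lemma pairing_unit_minus [simp]: "pairing A u (- u) = 1"
  using pairing_add[of u "- u" u] pairing_sym[of u "- u"] pairing_unit pairing_unit_0
    pairing_sym[of u 0] by (cases "pairing A (- u) u") auto

lemma cocycles_simps [simp]:
  "x \<in> carrier (cocycles A K i) \<longleftrightarrow> x \<in> carrier (grp K i) \<and> diff K i x = \<zero>\<^bsub>grp K (i + u)\<^esub>"
  "add (cocycles A K i) = add (grp K i)"
  "zero (cocycles A K i) = zero (grp K i)"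
  by (auto simp: cocycles_def)

lemma G_abelian: "\<lbrakk>X \<in> Ob A; Y \<in> Ob A\<rbrakk> \<Longrightarrow> abelian_group (G X Y i)"
  using Hom_complex by (simp add: is_complex_def)

lemma G_simps [simp]:
  assumes "X \<in> Ob A" "Y \<in> Ob A"
  shows "\<zero>\<^bsub>G X Y i\<^esub> \<in> carrier (G X Y i)"
    and "\<lbrakk>x \<in> carrier (G X Y i); y \<in> carrier (G X Y i)\<rbrakk> \<Longrightarrow> x \<oplus>\<^bsub>G X Y i\<^esub> y \<in> carrier (G X Y i)"
    and "x \<in> carrier (G X Y i) \<Longrightarrow> \<ominus>\<^bsub>G X Y i\<^esub> x \<in> carrier (G X Y i)"
    and "x \<in> carrier (G X Y i) \<Longrightarrow> \<zero>\<^bsub>G X Y i\<^esub> \<oplus>\<^bsub>G X Y i\<^esub> x = x"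
    and "x \<in> carrier (G X Y i) \<Longrightarrow> x \<oplus>\<^bsub>G X Y i\<^esub> \<zero>\<^bsub>G X Y i\<^esub> = x"
    and "x \<in> carrier (G X Y i) \<Longrightarrow> \<ominus>\<^bsub>G X Y i\<^esub> x \<oplus>\<^bsub>G X Y i\<^esub> x = \<zero>\<^bsub>G X Y i\<^esub>"
    and "x \<in> carrier (G X Y i) \<Longrightarrow> x \<oplus>\<^bsub>G X Y i\<^esub> \<ominus>\<^bsub>G X Y i\<^esub> x = \<zero>\<^bsub>G X Y i\<^esub>"
    and "x \<in> carrier (G X Y i) \<Longrightarrow> \<ominus>\<^bsub>G X Y i\<^esub> (\<ominus>\<^bsub>G X Y i\<^esub> x) = x"
    and "\<ominus>\<^bsub>G X Y i\<^esub> \<zero>\<^bsub>G X Y i\<^esub> = \<zero>\<^bsub>G X Y i\<^esub>"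
proof -
  interpret abelian_group "G X Y i" by (rule G_abelian[OF assms])
  show "\<zero>\<^bsub>G X Y i\<^esub> \<in> carrier (G X Y i)" "\<ominus>\<^bsub>G X Y i\<^esub> \<zero>\<^bsub>G X Y i\<^esub> = \<zero>\<^bsub>G X Y i\<^esub>"
    by (simp_all add: add.inv_one[folded a_inv_def])
qed (use G_abelian[OF assms, of i] abelian_group.axioms(1)[OF G_abelian[OF assms, of i]] in
      \<open>simp_all add: abelian_monoid.a_closed abelian_monoid.l_zero abelian_monoid.r_zero
        abelian_group.a_inv_closed abelian_group.l_neg abelian_group.r_neg abelian_group.minus_minus\<close>)

lemma d_hom: "\<lbrakk>X \<in> Ob A; Y \<in> Ob A\<rbrakk> \<Longrightarrow>
    group_hom (add_monoid (G X Y i)) (add_monoid (G X Y (i + u))) (d X Y i)"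
  using Hom_complex[of X Y] unfolding group_hom_def group_hom_axioms_def
  by (intro conjI abelian_group.a_group G_abelian) (simp_all add: is_complex_def)

lemma d_simps [simp]:
  assumes "X \<in> Ob A" "Y \<in> Ob A"
  shows "\<lbrakk>j = i + u; x \<in> carrier (G X Y i)\<rbrakk> \<Longrightarrow> d X Y i x \<in> carrier (G X Y j)"
    and "\<lbrakk>x \<in> carrier (G X Y i); y \<in> carrier (G X Y i)\<rbrakk> \<Longrightarrow>
          d X Y i (x \<oplus>\<^bsub>G X Y i\<^esub> y) = d X Y i x \<oplus>\<^bsub>G X Y (i + u)\<^esub> d X Y i y"
    and "d X Y i \<zero>\<^bsub>G X Y i\<^esub> = \<zero>\<^bsub>G X Y (i + u)\<^esub>"
    and "x \<in> carrier (G X Y i) \<Longrightarrow> d X Y i (\<ominus>\<^bsub>G X Y i\<^esub> x) = \<ominus>\<^bsub>G X Y (i + u)\<^esub> d X Y i x"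
  using group_hom.hom_closed[OF d_hom[OF assms], of x i] group_hom.hom_mult[OF d_hom[OF assms], of x i y]
    group_hom.hom_one[OF d_hom[OF assms], of i] group_hom.hom_inv[OF d_hom[OF assms], of x i]
  by (auto simp: a_inv_def)

lemma Idn_simps [simp]:
  assumes "X \<in> Ob A"
  shows "Idn A X \<in> carrier (G X X 0)" "d X X 0 (Idn A X) = \<zero>\<^bsub>G X X u\<^esub>"
  using Idn_closed[OF assms] by auto

lemma Cmp_mem [simp]:
  "\<lbrakk>X \<in> Ob A; Y \<in> Ob A; Z \<in> Ob A; g \<in> carrier (G Y Z i); f \<in> carrier (G X Y j); n = i + j\<rbrakk>
    \<Longrightarrow> Cmp A X Y Z i j g f \<in> carrier (G X Z n)"
  using Cmp_closed by simp

lemma Cmp_hom_left: "\<lbrakk>X \<in> Ob A; Y \<in> Ob A; Z \<in> Ob A; f \<in> carrier (G X Y j)\<rbrakk> \<Longrightarrow>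
    group_hom (add_monoid (G Y Z i)) (add_monoid (G X Z (i + j))) (\<lambda>g. Cmp A X Y Z i j g f)"
  unfolding group_hom_def group_hom_axioms_def
  by (intro conjI abelian_group.a_group G_abelian) (simp_all add: hom_def Cmp_add_left)

lemma Cmp_hom_right: "\<lbrakk>X \<in> Ob A; Y \<in> Ob A; Z \<in> Ob A; g \<in> carrier (G Y Z i)\<rbrakk> \<Longrightarrow>
    group_hom (add_monoid (G X Y j)) (add_monoid (G X Z (i + j))) (\<lambda>f. Cmp A X Y Z i j g f)"
  unfolding group_hom_def group_hom_axioms_def
  by (intro conjI abelian_group.a_group G_abelian) (simp_all add: hom_def Cmp_add_right)

lemma Cmp_zero_left [simp]:
  "\<lbrakk>X \<in> Ob A; Y \<in> Ob A; Z \<in> Ob A; f \<in> carrier (G X Y j)\<rbrakk> \<Longrightarrow>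
    Cmp A X Y Z i j \<zero>\<^bsub>G Y Z i\<^esub> f = \<zero>\<^bsub>G X Z (i + j)\<^esub>"
  using group_hom.hom_one[OF Cmp_hom_left] by fastforce

lemma Cmp_zero_right [simp]:
  "\<lbrakk>X \<in> Ob A; Y \<in> Ob A; Z \<in> Ob A; g \<in> carrier (G Y Z i)\<rbrakk> \<Longrightarrow>
    Cmp A X Y Z i j g \<zero>\<^bsub>G X Y j\<^esub> = \<zero>\<^bsub>G X Z (i + j)\<^esub>"
  using group_hom.hom_one[OF Cmp_hom_right] by fastforce

lemma Cmp_minus_left [simp]:
  "\<lbrakk>X \<in> Ob A; Y \<in> Ob A; Z \<in> Ob A; g \<in> carrier (G Y Z i); f \<in> carrier (G X Y j)\<rbrakk> \<Longrightarrow>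
    Cmp A X Y Z i j (\<ominus>\<^bsub>G Y Z i\<^esub> g) f = \<ominus>\<^bsub>G X Z (i + j)\<^esub> Cmp A X Y Z i j g f"
  using group_hom.hom_inv[OF Cmp_hom_left, of X Y Z f j g i] by (simp add: a_inv_def)

lemma Cmp_minus_right [simp]:
  "\<lbrakk>X \<in> Ob A; Y \<in> Ob A; Z \<in> Ob A; g \<in> carrier (G Y Z i); f \<in> carrier (G X Y j)\<rbrakk> \<Longrightarrow>
    Cmp A X Y Z i j g (\<ominus>\<^bsub>G X Y j\<^esub> f) = \<ominus>\<^bsub>G X Z (i + j)\<^esub> Cmp A X Y Z i j g f"
  using group_hom.hom_inv[OF Cmp_hom_right, of X Y Z g i f j] by (simp add: a_inv_def)

text \<open>
  The degrees in a composite are sums such as \<open>- u + u\<close>, which the simplifier rewrites at once. The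
  degree of a composite is therefore a variable constrained by an equation, so that the rule still
  matches after this rewriting.
\<close>

lemma Cmp_assoc' [simp]:
  "\<lbrakk>W \<in> Ob A; X \<in> Ob A; Y \<in> Ob A; Z \<in> Ob A; h \<in> carrier (G Y Z i);
    g \<in> carrier (G X Y j); f \<in> carrier (G W X k); m = i + j\<rbrakk>
    \<Longrightarrow> Cmp A W X Z m k (Cmp A X Y Z i j h g) f = Cmp A W Y Z i (j + k) h (Cmp A W X Y j k g f)"
  using Cmp_assoc by simp

lemma d_Cmp [simp]:
  "\<lbrakk>X \<in> Ob A; Y \<in> Ob A; Z \<in> Ob A; g \<in> carrier (G Y Z i); f \<in> carrier (G X Y j); m = i + j\<rbrakk>
    \<Longrightarrow> d X Z m (Cmp A X Y Z i j g f)
      = Cmp A X Y Z (i + u) j (d Y Z i g) f \<oplus>\<^bsub>G X Z (m + u)\<^esub>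
        ksign (G X Z (m + u)) (pairing A u i) (Cmp A X Y Z i (j + u) g (d X Y j f))"
  using Cmp_diff by simp

lemma ksign_simps [simp]: "ksign K 0 x = x" "ksign K 1 x = \<ominus>\<^bsub>K\<^esub> x"
  by (auto simp: ksign_def)

text \<open>
  Iterated composites are kept associated to the right; there a relation \<open>g f = r\<close> has to be used in
  the form \<open>g (f x) = r x\<close>.
\<close>

lemma Cmp_chain:
  assumes "X \<in> Ob A" "Y \<in> Ob A" "Z \<in> Ob A" "g \<in> carrier (G Y Z i)" "f \<in> carrier (G X Y j)"
    and "Cmp A X Y Z i j g f = r" "n = i + j"
    and "W \<in> Ob A" "x \<in> carrier (G W X k)" "m = j + k"
  shows "Cmp A W Y Z i m g (Cmp A W X Y j k f x) = Cmp A W X Z n k r x"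
  using Cmp_assoc'[of W X Y Z g i f j x k n] assms by simp

declare pairing_unit [simp] Idn_left [simp] Idn_right [simp] Cmp_add_left [simp] Cmp_add_right [simp]

section \<open>The categories of closed morphisms of degree zero\<close>

lemma Z0_simps:
  "Obj (Z0 A) = Ob A" "Mor (Z0 A) X Y = cocycles A (Hom A X Y) 0"
  "Comp (Z0 A) X Y Z = Cmp A X Y Z 0 0" "Ident (Z0 A) = Idn A"
  by (simp_all add: Z0_def)

lemma preadditive_Z0: "preadditive_category (Z0 A)"
proof (rule preadditive_category.intro)
  fix X Y assume "X \<in> Obj (Z0 A)" "Y \<in> Obj (Z0 A)"
  then have "X \<in> Ob A" "Y \<in> Ob A" by (simp_all add: Z0_def)
  then have "abelian_group (cocycles A (Hom A X Y) 0)"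
    unfolding cocycles_def by (intro abelian_group_subgroup) (auto simp: G_abelian)
  then show "abelian_group (Mor (Z0 A) X Y)" by (simp add: Z0_def)
qed (auto simp: Z0_def)

lemma Ob_natural: "Ob (dg_natural A) = {(X, s). X \<in> Ob A \<and> s \<in> carrier (G X X (- u)) \<and>
    d X X (- u) s = Idn A X \<and> Cmp A X X X (- u) (- u) s s = \<zero>\<^bsub>G X X (- u - u)\<^esub>}"
  by (simp add: dg_natural_def)

lemma Z0_natural_simps:
  "Obj (Z0 (dg_natural A)) = Ob (dg_natural A)"
  "Comp (Z0 (dg_natural A)) (X, s) (Y, t) (Z, r) = Cmp A X Y Z 0 0"
  "Ident (Z0 (dg_natural A)) (X, s) = Idn A X"
  "add (Mor (Z0 (dg_natural A)) (X, s) (Y, t)) = add (G X Y 0)"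
  by (simp_all add: Z0_def dg_natural_def cocycles_def)

text \<open>
  Addition and zero of this group are those of \<open>Hom\<^sup>0(X, Y)\<close>, so the group axioms only require that
  its carrier is a subgroup.
\<close>

lemma Mor_natural_eq: "Mor (Z0 (dg_natural A)) (X, s) (Y, t) =
    (G X Y 0)\<lparr>carrier := carrier (Mor (Z0 (dg_natural A)) (X, s) (Y, t))\<rparr>"
  by (simp add: Z0_def dg_natural_def cocycles_def)

lemma minus_eq_zero_iff:
  assumes "abelian_group K" "x \<in> carrier K" "y \<in> carrier K"
  shows "x \<ominus>\<^bsub>K\<^esub> y = \<zero>\<^bsub>K\<^esub> \<longleftrightarrow> x = y"
proof -
  interpret abelian_group K by fact
  show ?thesis using assms by (metis minus_eq  minus_equality minus_minus r_neg a_inv_closed)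
qed

text \<open>
  The degree \<open>0\<close> cocycles for the differential \<open>d\<^sup>\<natural>\<close> are the morphisms that commute with the
  homotopies.
\<close>

lemma Mor_natural_iff:
  assumes "(X, s) \<in> Ob (dg_natural A)" "(Y, t) \<in> Ob (dg_natural A)"
  shows "f \<in> carrier (Mor (Z0 (dg_natural A)) (X, s) (Y, t)) \<longleftrightarrow>
    f \<in> carrier (G X Y 0) \<and> d X Y 0 f = \<zero>\<^bsub>G X Y u\<^esub> \<and>
    Cmp A X Y Y (- u) 0 t f = Cmp A X X Y 0 (- u) f s"
proof -
  have [simp]: "X \<in> Ob A" "Y \<in> Ob A" "s \<in> carrier (G X X (- u))" "t \<in> carrier (G Y Y (- u))"
    using assms by (simp_all add: Ob_natural)
  have "f \<in> carrier (Mor (Z0 (dg_natural A)) (X, s) (Y, t)) \<longleftrightarrow>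
      f \<in> carrier (G X Y 0) \<and> d X Y 0 f = \<zero>\<^bsub>G X Y u\<^esub> \<and>
      Cmp A X Y Y (- u) 0 t f \<ominus>\<^bsub>G X Y (- u)\<^esub> Cmp A X X Y 0 (- u) f s = \<zero>\<^bsub>G X Y (- u)\<^esub>"
    by (simp add: Z0_def dg_natural_def cocycles_def)
  moreover have "Cmp A X Y Y (- u) 0 t f \<ominus>\<^bsub>G X Y (- u)\<^esub> Cmp A X X Y 0 (- u) f s = \<zero>\<^bsub>G X Y (- u)\<^esub>
      \<longleftrightarrow> Cmp A X Y Y (- u) 0 t f = Cmp A X X Y 0 (- u) f s" if "f \<in> carrier (G X Y 0)"
    using that by (intro minus_eq_zero_iff G_abelian) simp_all
  ultimately show ?thesis by blast
qed

lemma preadditive_Z0_natural: "preadditive_category (Z0 (dg_natural A))"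
proof (rule preadditive_category.intro)
  fix x y assume xy: "x \<in> Obj (Z0 (dg_natural A))" "y \<in> Obj (Z0 (dg_natural A))"
  obtain X s Y t where [simp]: "x = (X, s)" "y = (Y, t)" by fastforce
  have [simp]: "X \<in> Ob A" "Y \<in> Ob A" "s \<in> carrier (G X X (- u))" "t \<in> carrier (G Y Y (- u))"
    using xy by (auto simp: Z0_natural_simps Ob_natural)
  have iff: "f \<in> carrier (Mor (Z0 (dg_natural A)) (X, s) (Y, t)) \<longleftrightarrow>
    f \<in> carrier (G X Y 0) \<and> d X Y 0 f = \<zero>\<^bsub>G X Y u\<^esub> \<and>
    Cmp A X Y Y (- u) 0 t f = Cmp A X X Y 0 (- u) f s" for f
    using xy by (simp add: Z0_natural_simps Mor_natural_iff)
  show "abelian_group (Mor (Z0 (dg_natural A)) x y)"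
    unfolding \<open>x = _\<close> \<open>y = _\<close>
    by (subst Mor_natural_eq, intro abelian_group_subgroup) (auto simp: G_abelian iff)
next
  fix x y z g f assume *: "x \<in> Obj (Z0 (dg_natural A))" "y \<in> Obj (Z0 (dg_natural A))"
    "z \<in> Obj (Z0 (dg_natural A))" "g \<in> carrier (Mor (Z0 (dg_natural A)) y z)"
    "f \<in> carrier (Mor (Z0 (dg_natural A)) x y)"
  obtain X s Y t Z r where xyz: "x = (X, s)" "y = (Y, t)" "z = (Z, r)" by (metis surj_pair)
  have Ob: "(X, s) \<in> Ob (dg_natural A)" "(Y, t) \<in> Ob (dg_natural A)" "(Z, r) \<in> Ob (dg_natural A)"
    using * by (simp_all add: xyz Z0_natural_simps)
  have [simp]: "X \<in> Ob A" "Y \<in> Ob A" "Z \<in> Ob A" "s \<in> carrier (G X X (- u))"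
    "t \<in> carrier (G Y Y (- u))" "r \<in> carrier (G Z Z (- u))"
    using Ob by (auto simp: Ob_natural)
  have fg [simp]: "f \<in> carrier (G X Y 0)" "d X Y 0 f = \<zero>\<^bsub>G X Y u\<^esub>"
      "Cmp A X Y Y (- u) 0 t f = Cmp A X X Y 0 (- u) f s"
      "g \<in> carrier (G Y Z 0)" "d Y Z 0 g = \<zero>\<^bsub>G Y Z u\<^esub>"
      "Cmp A Y Z Z (- u) 0 r g = Cmp A Y Y Z 0 (- u) g t"
    using * Ob by (simp_all add: xyz Mor_natural_iff)
  have "Cmp A X Z Z (- u) 0 r (Cmp A X Y Z 0 0 g f) = Cmp A X Y Z (- u) 0 (Cmp A Y Y Z 0 (- u) g t) f"
    by (rule Cmp_chain) auto
  then show "Comp (Z0 (dg_natural A)) x y z g f \<in> carrier (Mor (Z0 (dg_natural A)) x z)"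
    using Ob by (simp add: xyz Z0_natural_simps Mor_natural_iff)
qed (auto simp: Z0_natural_simps Mor_natural_iff Ob_natural)

end

section \<open>Disks and the functor \<open>\<Phi>\<close>\<close>

text \<open>
  The functors depend on the choice of a disk on every object, but not on how the disks are
  constructed.
\<close>

locale dg_category_with_disks = dg_category A
  for A :: "('o, 'm, 'g::ab_group_add) dgcat" +
  fixes D :: "'o \<Rightarrow> 'o" and \<iota> \<iota>' \<pi> \<pi>' :: "'o \<Rightarrow> 'm"
  assumes D_Ob [simp]: "X \<in> Ob A \<Longrightarrow> D X \<in> Ob A"
    and disk_mem [simp]: "X \<in> Ob A \<Longrightarrow> \<iota> X \<in> carrier (G X (D X) u)"
      "X \<in> Ob A \<Longrightarrow> \<iota>' X \<in> carrier (G X (D X) 0)"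
      "X \<in> Ob A \<Longrightarrow> \<pi> X \<in> carrier (G (D X) X 0)"
      "X \<in> Ob A \<Longrightarrow> \<pi>' X \<in> carrier (G (D X) X (- u))"
    and disk_d [simp]: "X \<in> Ob A \<Longrightarrow> d X (D X) 0 (\<iota>' X) = \<iota> X"
      "X \<in> Ob A \<Longrightarrow> d X (D X) u (\<iota> X) = \<zero>\<^bsub>G X (D X) (u + u)\<^esub>"
      "X \<in> Ob A \<Longrightarrow> d (D X) X (- u) (\<pi>' X) = \<pi> X"
      "X \<in> Ob A \<Longrightarrow> d (D X) X 0 (\<pi> X) = \<zero>\<^bsub>G (D X) X u\<^esub>"
    and disk_Cmp [simp]: "X \<in> Ob A \<Longrightarrow> Cmp A X (D X) X (- u) 0 (\<pi>' X) (\<iota>' X) = \<zero>\<^bsub>G X X (- u)\<^esub>"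
      "X \<in> Ob A \<Longrightarrow> Cmp A X (D X) X 0 u (\<pi> X) (\<iota> X) = \<zero>\<^bsub>G X X u\<^esub>"
      "X \<in> Ob A \<Longrightarrow> Cmp A X (D X) X (- u) u (\<pi>' X) (\<iota> X) = Idn A X"
      "X \<in> Ob A \<Longrightarrow> Cmp A X (D X) X 0 0 (\<pi> X) (\<iota>' X) = Idn A X"
    and disk_sum: "X \<in> Ob A \<Longrightarrow> Cmp A (D X) X (D X) u (- u) (\<iota> X) (\<pi>' X) \<oplus>\<^bsub>G (D X) (D X) 0\<^esub>
        Cmp A (D X) X (D X) 0 0 (\<iota>' X) (\<pi> X) = Idn A (D X)"
begin

lemma disk_chain [simp]:
  assumes [simp]: "X \<in> Ob A" "W \<in> Ob A" "x \<in> carrier (G W X k)"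
  shows "m = k \<Longrightarrow> Cmp A W (D X) X (- u) m (\<pi>' X) (Cmp A W X (D X) 0 k (\<iota>' X) x) = \<zero>\<^bsub>G W X (- u + k)\<^esub>"
    and "m = u + k \<Longrightarrow> Cmp A W (D X) X 0 m (\<pi> X) (Cmp A W X (D X) u k (\<iota> X) x) = \<zero>\<^bsub>G W X (u + k)\<^esub>"
    and "m = u + k \<Longrightarrow> Cmp A W (D X) X (- u) m (\<pi>' X) (Cmp A W X (D X) u k (\<iota> X) x) = x"
    and "m = k \<Longrightarrow> Cmp A W (D X) X 0 m (\<pi> X) (Cmp A W X (D X) 0 k (\<iota>' X) x) = x"
  by (subst Cmp_chain, auto)+

text \<open>
  A morphism into a disk is determined by its composites with \<open>\<pi>'\<close> and \<open>\<pi>\<close>, because the disk is a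
  biproduct.
\<close>

lemma disk_decompose:
  assumes [simp]: "X \<in> Ob A" "W \<in> Ob A" "h \<in> carrier (G W (D X) k)"
  shows "h = Cmp A W X (D X) u (- u + k) (\<iota> X) (Cmp A W (D X) X (- u) k (\<pi>' X) h) \<oplus>\<^bsub>G W (D X) k\<^esub>
      Cmp A W X (D X) 0 k (\<iota>' X) (Cmp A W (D X) X 0 k (\<pi> X) h)"
proof -
  have "h = Cmp A W (D X) (D X) 0 k (Cmp A (D X) X (D X) u (- u) (\<iota> X) (\<pi>' X) \<oplus>\<^bsub>G (D X) (D X) 0\<^esub>
        Cmp A (D X) X (D X) 0 0 (\<iota>' X) (\<pi> X)) h"
    by (simp only: disk_sum[OF assms(1)]) simp
  then show ?thesis by simp
qed

lemma disk_codecompose: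
  assumes [simp]: "X \<in> Ob A" "W \<in> Ob A" "h \<in> carrier (G (D X) W k)"
  shows "h = Cmp A (D X) X W (k + u) (- u) (Cmp A X (D X) W k u h (\<iota> X)) (\<pi>' X) \<oplus>\<^bsub>G (D X) W k\<^esub>
      Cmp A (D X) X W k 0 (Cmp A X (D X) W k 0 h (\<iota>' X)) (\<pi> X)"
proof -
  have "h = Cmp A (D X) (D X) W k 0 h (Cmp A (D X) X (D X) u (- u) (\<iota> X) (\<pi>' X) \<oplus>\<^bsub>G (D X) (D X) 0\<^esub>
        Cmp A (D X) X (D X) 0 0 (\<iota>' X) (\<pi> X))"
    by (simp only: disk_sum[OF assms(1)]) simp
  then show ?thesis by simp
qed

definition disk_homotopy :: "'o \<Rightarrow> 'm" where
  "disk_homotopy X = Cmp A (D X) X (D X) 0 (- u) (\<iota>' X) (\<pi>' X)"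

definition disk_map :: "'o \<Rightarrow> 'o \<Rightarrow> 'm \<Rightarrow> 'm" where
  "disk_map X Y f =
     Cmp A (D X) Y (D Y) u (- u) (\<iota> Y) (Cmp A (D X) X Y 0 (- u) f (\<pi>' X))
       \<oplus>\<^bsub>G (D X) (D Y) 0\<^esub>
     Cmp A (D X) Y (D Y) 0 0 (\<iota>' Y) (Cmp A (D X) X Y 0 0 f (\<pi> X))"

definition \<Phi> :: "('o, 'm, 'o \<times> 'm, 'm) functor_data" where
  "\<Phi> = \<lparr>FOb = \<lambda>X. (D X, disk_homotopy X), FMor = disk_map\<rparr>"

lemma disk_homotopy_mem [simp]: "X \<in> Ob A \<Longrightarrow> disk_homotopy X \<in> carrier (G (D X) (D X) (- u))"
  by (simp add: disk_homotopy_def)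

text \<open>
  The homotopy \<open>\<iota>' \<pi>'\<close> is contracting since \<open>d (\<iota>' \<pi>') = \<iota> \<pi>' + \<iota>' \<pi> = id\<close>; its square vanishes since
  \<open>\<pi>' \<iota>' = 0\<close>.
\<close>

lemma disk_in_natural: "X \<in> Ob A \<Longrightarrow> (D X, disk_homotopy X) \<in> Ob (dg_natural A)"
  using disk_sum[of X] by (simp add: Ob_natural disk_homotopy_def)

lemma disk_map_mem [simp]:
  "\<lbrakk>X \<in> Ob A; Y \<in> Ob A; f \<in> carrier (G X Y 0)\<rbrakk> \<Longrightarrow> disk_map X Y f \<in> carrier (G (D X) (D Y) 0)"
  by (simp add: disk_map_def)

lemma disk_map_\<iota> [simp]:
  "\<lbrakk>X \<in> Ob A; Y \<in> Ob A; f \<in> carrier (G X Y 0)\<rbrakk> \<Longrightarrow>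
    Cmp A X (D X) (D Y) 0 u (disk_map X Y f) (\<iota> X) = Cmp A X Y (D Y) u 0 (\<iota> Y) f"
  by (simp add: disk_map_def)

lemma disk_map_\<iota>' [simp]:
  "\<lbrakk>X \<in> Ob A; Y \<in> Ob A; f \<in> carrier (G X Y 0)\<rbrakk> \<Longrightarrow>
    Cmp A X (D X) (D Y) 0 0 (disk_map X Y f) (\<iota>' X) = Cmp A X Y (D Y) 0 0 (\<iota>' Y) f"
  by (simp add: disk_map_def)

lemma \<pi>_disk_map [simp]:
  "\<lbrakk>X \<in> Ob A; Y \<in> Ob A; f \<in> carrier (G X Y 0)\<rbrakk> \<Longrightarrow>
    Cmp A (D X) (D Y) Y 0 0 (\<pi> Y) (disk_map X Y f) = Cmp A (D X) X Y 0 0 f (\<pi> X)"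
  by (simp add: disk_map_def)

lemma \<pi>_disk_map_chain [simp]:
  "\<lbrakk>X \<in> Ob A; Y \<in> Ob A; W \<in> Ob A; f \<in> carrier (G X Y 0); h \<in> carrier (G W (D X) k)\<rbrakk> \<Longrightarrow>
    Cmp A W (D Y) Y 0 k (\<pi> Y) (Cmp A W (D X) (D Y) 0 k (disk_map X Y f) h)
      = Cmp A W X Y 0 k f (Cmp A W (D X) X 0 k (\<pi> X) h)"
  by (subst Cmp_chain[OF _ _ _ _ _ \<pi>_disk_map]) auto

lemma \<pi>'_disk_map [simp]:
  "\<lbrakk>X \<in> Ob A; Y \<in> Ob A; f \<in> carrier (G X Y 0)\<rbrakk> \<Longrightarrow>
    Cmp A (D X) (D Y) Y (- u) 0 (\<pi>' Y) (disk_map X Y f) = Cmp A (D X) X Y 0 (- u) f (\<pi>' X)"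
  by (simp add: disk_map_def)

text \<open>
  In \<open>d (\<iota> f \<pi>' + \<iota>' f \<pi>)\<close>, the first summand contributes \<open>- \<iota> f \<pi>\<close>, with the sign coming from the degree \<open>1\<close>
  of \<open>\<iota>\<close>, and the second one \<open>\<iota> f \<pi>\<close>. Composing with the homotopies on either side gives \<open>\<iota>' f \<pi>'\<close>.
\<close>

lemma disk_map_natural:
  assumes [simp]: "X \<in> Ob A" "Y \<in> Ob A" "f \<in> carrier (G X Y 0)" "d X Y 0 f = \<zero>\<^bsub>G X Y u\<^esub>"
  shows "disk_map X Y f \<in> carrier (Mor (Z0 (dg_natural A)) (D X, disk_homotopy X) (D Y, disk_homotopy Y))"
  unfolding Mor_natural_iff[OF disk_in_natural[OF assms(1)] disk_in_natural[OF assms(2)]]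
proof (intro conjI)
  show "d (D X) (D Y) 0 (disk_map X Y f) = \<zero>\<^bsub>G (D X) (D Y) u\<^esub>"
    by (simp add: disk_map_def)
  have "Cmp A (D X) (D X) (D Y) 0 (- u) (disk_map X Y f) (disk_homotopy X) =
      Cmp A (D X) X (D Y) 0 (- u) (Cmp A X Y (D Y) 0 0 (\<iota>' Y) f) (\<pi>' X)"
    unfolding disk_homotopy_def by (rule Cmp_chain) auto
  then show "Cmp A (D X) (D Y) (D Y) (- u) 0 (disk_homotopy Y) (disk_map X Y f) =
    Cmp A (D X) (D X) (D Y) 0 (- u) (disk_map X Y f) (disk_homotopy X)"
    by (simp add: disk_homotopy_def)
qed simp

lemma disk_map_Idn: "X \<in> Ob A \<Longrightarrow> disk_map X X (Idn A X) = Idn A (D X)"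
  by (simp add: disk_map_def disk_sum)

lemma disk_map_Cmp:
  "\<lbrakk>X \<in> Ob A; Y \<in> Ob A; Z \<in> Ob A; g \<in> carrier (G Y Z 0); f \<in> carrier (G X Y 0)\<rbrakk> \<Longrightarrow>
    disk_map X Z (Cmp A X Y Z 0 0 g f) = Cmp A (D X) (D Y) (D Z) 0 0 (disk_map Y Z g) (disk_map X Y f)"
  by (simp add: disk_map_def)

lemma disk_map_add:
  assumes [simp]: "X \<in> Ob A" "Y \<in> Ob A" "f \<in> carrier (G X Y 0)" "g \<in> carrier (G X Y 0)"
  shows "disk_map X Y (f \<oplus>\<^bsub>G X Y 0\<^esub> g) = disk_map X Y f \<oplus>\<^bsub>G (D X) (D Y) 0\<^esub> disk_map X Y g"
proof -
  interpret abelian_group "G (D X) (D Y) 0" by (simp add: G_abelian)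
  show ?thesis by (simp add: disk_map_def a_ac)
qed

lemma additive_\<Phi>: "additive_functor (Z0 A) (Z0 (dg_natural A)) \<Phi>"
proof -
  interpret Z: preadditive_category "Z0 A" by (rule preadditive_Z0)
  interpret N: preadditive_category "Z0 (dg_natural A)" by (rule preadditive_Z0_natural)
  show ?thesis
    by unfold_locales
      (simp_all add: \<Phi>_def Z0_simps Z0_natural_simps disk_in_natural disk_map_natural disk_map_Idn
        disk_map_Cmp disk_map_add)
qed


lemma faithful_\<Phi>: "faithful (Z0 A) \<Phi>"
  unfolding faithful_def
proof (intro ballI inj_onI)
  fix X Y f g
  assume "X \<in> Obj (Z0 A)" "Y \<in> Obj (Z0 A)" "f \<in> carrier (Mor (Z0 A) X Y)"
    "g \<in> carrier (Mor (Z0 A) X Y)" and eq: "FMor \<Phi> X Y f = FMor \<Phi> X Y g"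
  then have [simp]: "X \<in> Ob A" "Y \<in> Ob A" "f \<in> carrier (G X Y 0)" "g \<in> carrier (G X Y 0)"
    by (simp_all add: Z0_simps)
  have "f = Cmp A X (D Y) Y 0 0 (\<pi> Y) (Cmp A X (D X) (D Y) 0 0 (disk_map X Y f) (\<iota>' X))" by simp
  also have "\<dots> = Cmp A X (D Y) Y 0 0 (\<pi> Y) (Cmp A X (D X) (D Y) 0 0 (disk_map X Y g) (\<iota>' X))"
    using eq by (simp only: \<Phi>_def functor_data.simps)
  also have "\<dots> = g" by simp
  finally show "f = g" .
qed

section \<open>The left adjoint\<close>

definition \<Psi>p :: "('o \<times> 'm, 'm, 'o, 'm) functor_data" where
  "\<Psi>p = \<lparr>FOb = fst, FMor = (\<lambda>_ _ f. f)\<rparr>"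

lemma \<Psi>p_functor: "category_functor (Z0 (dg_natural A)) (Z0 A) \<Psi>p"
proof -
  interpret Z: preadditive_category "Z0 A" by (rule preadditive_Z0)
  interpret N: preadditive_category "Z0 (dg_natural A)" by (rule preadditive_Z0_natural)
  show ?thesis
    by unfold_locales
      (auto simp: \<Psi>p_def Z0_simps Z0_natural_simps Mor_natural_iff, auto simp: Ob_natural)
qed

lemma \<Psi>p_faithful: "faithful (Z0 (dg_natural A)) \<Psi>p"
  by (simp add: faithful_def \<Psi>p_def inj_on_def)

text \<open>
  The inverse sends \<open>f\<close> to \<open>\<iota> f s + \<iota>' f\<close>: the component \<open>\<pi> h = f\<close> of \<open>h\<close> is arbitrary, and the other
  component is forced, as commuting with the homotopies gives \<open>\<pi>' h = \<pi> (\<iota>' \<pi>' h) = \<pi> h s\<close>.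
\<close>

lemma \<Psi>p_adjoint_bij:
  assumes x: "(X, s) \<in> Ob (dg_natural A)" and [simp]: "Y \<in> Ob A"
  shows "bij_betw (Cmp A X (D Y) Y 0 0 (\<pi> Y))
    (carrier (Mor (Z0 (dg_natural A)) (X, s) (D Y, disk_homotopy Y))) (carrier (Mor (Z0 A) X Y))"
proof (rule bij_betwI[where g = "\<lambda>f. Cmp A X Y (D Y) u (- u) (\<iota> Y) (Cmp A X X Y 0 (- u) f s)
      \<oplus>\<^bsub>G X (D Y) 0\<^esub> Cmp A X Y (D Y) 0 0 (\<iota>' Y) f"])
  have [simp]: "X \<in> Ob A" "s \<in> carrier (G X X (- u))" "d X X (- u) s = Idn A X"
    "Cmp A X X X (- u) (- u) s s = \<zero>\<^bsub>G X X (- u - u)\<^esub>"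
    using x by (simp_all add: Ob_natural)
  note iff = Mor_natural_iff[OF x disk_in_natural[OF assms(2)]]
  show "Cmp A X (D Y) Y 0 0 (\<pi> Y) \<in>
      carrier (Mor (Z0 (dg_natural A)) (X, s) (D Y, disk_homotopy Y)) \<rightarrow> carrier (Mor (Z0 A) X Y)"
    by (auto simp: iff Z0_simps)
  show "(\<lambda>f. Cmp A X Y (D Y) u (- u) (\<iota> Y) (Cmp A X X Y 0 (- u) f s)
      \<oplus>\<^bsub>G X (D Y) 0\<^esub> Cmp A X Y (D Y) 0 0 (\<iota>' Y) f) \<in> carrier (Mor (Z0 A) X Y) \<rightarrow>
      carrier (Mor (Z0 (dg_natural A)) (X, s) (D Y, disk_homotopy Y))"
    by (auto simp: iff Z0_simps) (simp add: disk_homotopy_def)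
  show "Cmp A X (D Y) Y 0 0 (\<pi> Y) (Cmp A X Y (D Y) u (- u) (\<iota> Y) (Cmp A X X Y 0 (- u) f s)
      \<oplus>\<^bsub>G X (D Y) 0\<^esub> Cmp A X Y (D Y) 0 0 (\<iota>' Y) f) = f" if "f \<in> carrier (Mor (Z0 A) X Y)" for f
    using that by (simp add: Z0_simps)
  show "Cmp A X Y (D Y) u (- u) (\<iota> Y) (Cmp A X X Y 0 (- u) (Cmp A X (D Y) Y 0 0 (\<pi> Y) h) s)
      \<oplus>\<^bsub>G X (D Y) 0\<^esub> Cmp A X Y (D Y) 0 0 (\<iota>' Y) (Cmp A X (D Y) Y 0 0 (\<pi> Y) h) = h"
    if "h \<in> carrier (Mor (Z0 (dg_natural A)) (X, s) (D Y, disk_homotopy Y))" for h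
  proof -
    have [simp]: "h \<in> carrier (G X (D Y) 0)"
      and comm: "Cmp A X (D Y) (D Y) (- u) 0 (disk_homotopy Y) h = Cmp A X X (D Y) 0 (- u) h s"
      using that by (simp_all add: iff)
    have "Cmp A X X Y 0 (- u) (Cmp A X (D Y) Y 0 0 (\<pi> Y) h) s =
        Cmp A X (D Y) Y 0 (- u) (\<pi> Y) (Cmp A X X (D Y) 0 (- u) h s)" by simp
    also have "\<dots> = Cmp A X (D Y) Y (- u) 0 (\<pi>' Y) h"
      unfolding comm[symmetric] by (simp add: disk_homotopy_def)
    finally show ?thesis using disk_decompose[of Y X h 0] by simp
  qed
qed

lemma \<Psi>p_left_adjoint: "left_adjoint (Z0 (dg_natural A)) (Z0 A) \<Psi>p \<Phi>"
proof (rule left_adjoint_by_inverse[where \<rho> = "\<lambda>x Y. Cmp A (fst x) (D Y) Y 0 0 (\<pi> Y)"])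
  show "category_functor (Z0 A) (Z0 (dg_natural A)) \<Phi>"
    using additive_\<Phi> by (simp add: additive_functor_def)
  show "bij_betw (Cmp A (fst x) (D Y) Y 0 0 (\<pi> Y))
      (carrier (Mor (Z0 (dg_natural A)) x (FOb \<Phi> Y))) (carrier (Mor (Z0 A) (FOb \<Psi>p x) Y))"
    if "x \<in> Obj (Z0 (dg_natural A))" "Y \<in> Obj (Z0 A)" for x Y
    using that \<Psi>p_adjoint_bij[of "fst x" "snd x" Y] by (simp add: \<Phi>_def \<Psi>p_def Z0_simps(1) Z0_natural_simps)
qed (rule \<Psi>p_functor, auto simp: \<Phi>_def \<Psi>p_def Z0_simps Z0_natural_simps Mor_natural_iff disk_in_natural,
     auto simp: Ob_natural)

end

section \<open>The right adjoint\<close>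

locale dg_category_with_disks_and_shift = dg_category_with_disks A D \<iota> \<iota>' \<pi> \<pi>'
  for A :: "('o, 'm, 'g::ab_group_add) dgcat" and D \<iota> \<iota>' \<pi> \<pi>' +
  fixes S :: "'o \<Rightarrow> ('o, 'm) shift"
  assumes S: "X \<in> Ob A \<Longrightarrow> is_shift A X u (S X)"
begin

abbreviation T :: "'o \<Rightarrow> 'o" where "T X \<equiv> sh_obj (S X)"
abbreviation to_shift :: "'o \<Rightarrow> 'm" where "to_shift X \<equiv> sh_in (S X)"
abbreviation from_shift :: "'o \<Rightarrow> 'm" where "from_shift X \<equiv> sh_out (S X)"

lemma shift_simps [simp]:
  assumes "X \<in> Ob A"
  shows "T X \<in> Ob A"
    and "to_shift X \<in> carrier (G X (T X) (- u))" "d X (T X) (- u) (to_shift X) = \<zero>\<^bsub>G X (T X) 0\<^esub>"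
    and "from_shift X \<in> carrier (G (T X) X u)" "d (T X) X u (from_shift X) = \<zero>\<^bsub>G (T X) X (u + u)\<^esub>"
    and "Cmp A X (T X) X u (- u) (from_shift X) (to_shift X) = Idn A X"
    and "Cmp A (T X) X (T X) (- u) u (to_shift X) (from_shift X) = Idn A (T X)"
  using S[OF assms] by (auto simp: is_shift_def)

lemma shift_chain [simp]:
  assumes [simp]: "X \<in> Ob A" "W \<in> Ob A"
  shows "\<lbrakk>x \<in> carrier (G W X k); m = - u + k\<rbrakk> \<Longrightarrow>
      Cmp A W (T X) X u m (from_shift X) (Cmp A W X (T X) (- u) k (to_shift X) x) = x"
    and "\<lbrakk>x \<in> carrier (G W (T X) k); m = u + k\<rbrakk> \<Longrightarrow>
      Cmp A W X (T X) (- u) m (to_shift X) (Cmp A W (T X) X u k (from_shift X) x) = x"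
  by (subst Cmp_chain, auto)+

definition \<Psi>m :: "('o \<times> 'm, 'm, 'o, 'm) functor_data" where
  "\<Psi>m = \<lparr>FOb = (\<lambda>x. T (fst x)),
          FMor = (\<lambda>x y. shift_map A u (fst x) (S (fst x)) (fst y) (S (fst y)))\<rparr>"

lemma \<Psi>m_functor: "category_functor (Z0 (dg_natural A)) (Z0 A) \<Psi>m"
proof -
  interpret Z: preadditive_category "Z0 A" by (rule preadditive_Z0)
  interpret N: preadditive_category "Z0 (dg_natural A)" by (rule preadditive_Z0_natural)
  show ?thesis
    by unfold_locales
      (auto simp: \<Psi>m_def shift_map_def Z0_simps Z0_natural_simps Mor_natural_iff, auto simp: Ob_natural)
qed

lemma \<Psi>m_faithful: "faithful (Z0 (dg_natural A)) \<Psi>m"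
  unfolding faithful_def
proof (intro ballI inj_onI)
  fix x y f g
  assume *: "x \<in> Obj (Z0 (dg_natural A))" "y \<in> Obj (Z0 (dg_natural A))"
    "f \<in> carrier (Mor (Z0 (dg_natural A)) x y)" "g \<in> carrier (Mor (Z0 (dg_natural A)) x y)"
    and eq: "FMor \<Psi>m x y f = FMor \<Psi>m x y g"
  obtain X s Y t where [simp]: "x = (X, s)" "y = (Y, t)" by fastforce
  have [simp]: "X \<in> Ob A" "Y \<in> Ob A" using *(1,2) by (auto simp: Z0_natural_simps Ob_natural)
  have fg: "f \<in> carrier (G X Y 0)" "g \<in> carrier (G X Y 0)"
    using * by (auto simp: Z0_natural_simps Mor_natural_iff)
  have recover: "Cmp A X (T Y) Y u (- u) (from_shift Y)
      (Cmp A X (T X) (T Y) 0 (- u) (FMor \<Psi>m x y h) (to_shift X)) = h"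
    if [simp]: "h \<in> carrier (G X Y 0)" for h
    by (simp add: \<Psi>m_def shift_map_def)
  show "f = g"
    by (rule box_equals[OF _ recover recover]) (simp_all only: eq fg)
qed

text \<open>
  Up to the isomorphism between \<open>Y\<close> and \<open>Y[1]\<close>, this is the bijection \<open>h \<mapsto> h \<iota>\<close> onto the closed morphisms
  \<open>X \<rightarrow> Y\<close> of degree \<open>1\<close>. The other component of \<open>h\<close> on the biproduct is forced to be
  \<open>h \<iota>' = (h \<iota>' \<pi>') \<iota> = t h \<iota>\<close>.
\<close>

lemma \<Psi>m_adjoint_bij:
  assumes [simp]: "X \<in> Ob A" and y: "(Y, t) \<in> Ob (dg_natural A)"
  shows "bij_betw (\<lambda>h. Cmp A X Y (T Y) (- u) u (to_shift Y) (Cmp A X (D X) Y 0 u h (\<iota> X)))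
    (carrier (Mor (Z0 (dg_natural A)) (D X, disk_homotopy X) (Y, t))) (carrier (Mor (Z0 A) X (T Y)))"
proof -
  have [simp]: "Y \<in> Ob A" "t \<in> carrier (G Y Y (- u))" "d Y Y (- u) t = Idn A Y"
    and tt: "Cmp A Y Y Y (- u) (- u) t t = \<zero>\<^bsub>G Y Y (- u - u)\<^esub>"
    using y by (simp_all add: Ob_natural)
  have [simp]: "Cmp A W Y Y (- u) m t (Cmp A W Y Y (- u) k t x) = \<zero>\<^bsub>G W Y (- u - u + k)\<^esub>"
    if "W \<in> Ob A" "x \<in> carrier (G W Y k)" "m = - u + k" for W x k m
    using that by (subst Cmp_chain[OF _ _ _ _ _ tt]) auto
  note iff = Mor_natural_iff[OF disk_in_natural[OF assms(1)] y]
  \<comment> \<open>the inverse of \<open>h \<mapsto> h \<iota>\<close>, with second component \<open>t g\<close>\<close>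
  define mate where "mate g = Cmp A (D X) X Y u (- u) g (\<pi>' X) \<oplus>\<^bsub>G (D X) Y 0\<^esub>
      Cmp A (D X) Y Y (- u) u t (Cmp A (D X) X Y u 0 g (\<pi> X))" for g
  have mate_mem: "mate g \<in> carrier (Mor (Z0 (dg_natural A)) (D X, disk_homotopy X) (Y, t))"
    if [simp]: "g \<in> carrier (G X Y u)" "d X Y u g = \<zero>\<^bsub>G X Y (u + u)\<^esub>" for g
    by (simp add: iff mate_def) (simp add: disk_homotopy_def)
  have mate_\<iota>: "Cmp A X (D X) Y 0 u (mate g) (\<iota> X) = g" if [simp]: "g \<in> carrier (G X Y u)" for g
    by (simp add: mate_def)
  have mate_eq: "mate (Cmp A X (D X) Y 0 u h (\<iota> X)) = h"
    if "h \<in> carrier (Mor (Z0 (dg_natural A)) (D X, disk_homotopy X) (Y, t))" for h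
  proof -
    have [simp]: "h \<in> carrier (G (D X) Y 0)"
      and comm: "Cmp A (D X) Y Y (- u) 0 t h = Cmp A (D X) (D X) Y 0 (- u) h (disk_homotopy X)"
      using that by (simp_all add: iff)
    have "Cmp A X Y Y (- u) u t (Cmp A X (D X) Y 0 u h (\<iota> X)) =
        Cmp A X (D X) Y (- u) u (Cmp A (D X) Y Y (- u) 0 t h) (\<iota> X)" by simp
    also have "\<dots> = Cmp A X (D X) Y 0 0 h (\<iota>' X)"
      unfolding comm by (simp add: disk_homotopy_def)
    finally have "Cmp A X (D X) Y 0 0 h (\<iota>' X) =
        Cmp A X Y Y (- u) u t (Cmp A X (D X) Y 0 u h (\<iota> X))" ..
    then show ?thesis using disk_codecompose[of X Y h 0] by (simp add: mate_def)
  qed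
  show ?thesis
  proof (rule bij_betwI[where g = "\<lambda>k. mate (Cmp A X (T Y) Y u 0 (from_shift Y) k)"])
    show "(\<lambda>h. Cmp A X Y (T Y) (- u) u (to_shift Y) (Cmp A X (D X) Y 0 u h (\<iota> X)))
      \<in> carrier (Mor (Z0 (dg_natural A)) (D X, disk_homotopy X) (Y, t)) \<rightarrow> carrier (Mor (Z0 A) X (T Y))"
      by (auto simp: iff Z0_simps)
    show "(\<lambda>k. mate (Cmp A X (T Y) Y u 0 (from_shift Y) k)) \<in> carrier (Mor (Z0 A) X (T Y)) \<rightarrow>
        carrier (Mor (Z0 (dg_natural A)) (D X, disk_homotopy X) (Y, t))"
      by (auto simp: Z0_simps intro!: mate_mem)
    show "mate (Cmp A X (T Y) Y u 0 (from_shift Y)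
        (Cmp A X Y (T Y) (- u) u (to_shift Y) (Cmp A X (D X) Y 0 u h (\<iota> X)))) = h"
      if "h \<in> carrier (Mor (Z0 (dg_natural A)) (D X, disk_homotopy X) (Y, t))" for h
      using mate_eq[OF that] that by (simp add: iff)
    show "Cmp A X Y (T Y) (- u) u (to_shift Y)
        (Cmp A X (D X) Y 0 u (mate (Cmp A X (T Y) Y u 0 (from_shift Y) k)) (\<iota> X)) = k"
      if "k \<in> carrier (Mor (Z0 A) X (T Y))" for k
      using that by (simp add: Z0_simps mate_\<iota>)
  qed
qed

lemma \<Psi>m_right_adjoint: "left_adjoint (Z0 A) (Z0 (dg_natural A)) \<Phi> \<Psi>m"
  unfolding left_adjoint_def
proof (intro conjI exI[of _ "\<lambda>X y h. Cmp A X (fst y) (T (fst y)) (- u) u (to_shift (fst y))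
      (Cmp A X (D X) (fst y) 0 u h (\<iota> X))"] ballI)
  show "category_functor (Z0 A) (Z0 (dg_natural A)) \<Phi>"
    using additive_\<Phi> by (simp add: additive_functor_def)
  show "bij_betw (\<lambda>h. Cmp A X (fst y) (T (fst y)) (- u) u (to_shift (fst y))
      (Cmp A X (D X) (fst y) 0 u h (\<iota> X))) (carrier (Mor (Z0 (dg_natural A)) (FOb \<Phi> X) y))
      (carrier (Mor (Z0 A) X (FOb \<Psi>m y)))"
    if "X \<in> Obj (Z0 A)" "y \<in> Obj (Z0 (dg_natural A))" for X y
    using that \<Psi>m_adjoint_bij[of X "fst y" "snd y"]
    by (simp add: \<Phi>_def \<Psi>m_def Z0_simps(1) Z0_natural_simps)
qed (rule \<Psi>m_functor, auto simp: \<Phi>_def \<Psi>m_def shift_map_def Z0_simps Z0_natural_simps Mor_natural_iff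
      disk_in_natural, auto simp: Ob_natural)

end

section \<open>Structure morphisms of cones\<close>

locale dg_cone = dg_category A
  for A :: "('o, 'm, 'g::ab_group_add) dgcat" +
  fixes X Y :: 'o and f :: 'm and K :: "('o, 'm, 'g) cone"
  assumes X [simp]: "X \<in> Ob A" and Y [simp]: "Y \<in> Ob A"
    and f: "f \<in> carrier (cocycles A (Hom A X Y) 0)"
    and K: "is_cone A X Y f K"
begin

abbreviation C where "C \<equiv> cn_obj K"
abbreviation p where "p \<equiv> cone_proj1 A K"
abbreviation q where "q \<equiv> cone_proj2 A K"
abbreviation i\<^sub>1 where "i\<^sub>1 \<equiv> cone_inj1 A X Y K"
abbreviation i\<^sub>2 where "i\<^sub>2 \<equiv> cone_inj2 A X Y K"

lemma f_simps [simp]: "f \<in> carrier (G X Y 0)" "d X Y 0 f = \<zero>\<^bsub>G X Y u\<^esub>"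
  using f by auto

lemma C_Ob [simp]: "C \<in> Ob A"
  using K by (simp add: is_cone_def)

lemma cn_iso_bij:
  assumes "Z \<in> Ob A"
  shows "bij_betw (cn_iso K Z i) (carrier (G Z C i)) (carrier (G Z X (i + u)) \<times> carrier (G Z Y i))"
  using K assms by (auto simp: is_cone_def complex_iso_def cone_complex_def iso_def RDirProd_carrier)

lemma proj_mem [simp]: "p \<in> carrier (G C X u)" "q \<in> carrier (G C Y 0)"
  using bspec[OF bij_betwE[OF cn_iso_bij[OF C_Ob, of 0]], of "Idn A C"]
  by (simp_all add: cone_proj1_def cone_proj2_def mem_Times_iff)

text \<open>
  The Yoneda argument: \<open>h = id h\<close>, and \<open>p\<close>, \<open>q\<close> are the components of the image of the identity.
\<close>

lemma cn_iso_eq: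
  assumes "Z \<in> Ob A" "h \<in> carrier (G Z C i)"
  shows "cn_iso K Z i h = (Cmp A Z C X u i p h, Cmp A Z C Y 0 i q h)"
proof -
  have "cn_iso K Z (0 + i) (Cmp A Z C C 0 i (Idn A C) h) =
      (Cmp A Z C X (0 + u) i p h, Cmp A Z C Y 0 i q h)"
    using K assms C_Ob Idn_simps(1)[OF C_Ob] unfolding is_cone_def cone_proj1_def cone_proj2_def by blast
  then show ?thesis using assms by simp
qed

lemma cone_eqI:
  assumes "Z \<in> Ob A" "h \<in> carrier (G Z C i)" "h' \<in> carrier (G Z C i)"
    and "Cmp A Z C X u i p h = Cmp A Z C X u i p h'" "Cmp A Z C Y 0 i q h = Cmp A Z C Y 0 i q h'"
  shows "h = h'"
  using bij_betw_imp_inj_on[OF cn_iso_bij[OF assms(1), of i]] assms by (auto simp: inj_on_def cn_iso_eq)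

text \<open>
  Compatibility of the representing isomorphisms with the differentials, in terms of \<open>p\<close> and \<open>q\<close>.
  Taking for \<open>h\<close> the identity or one of the injections gives the differentials of the four structure
  morphisms.
\<close>

lemma cn_iso_d:
  assumes "Z \<in> Ob A" "h \<in> carrier (G Z C i)"
  shows "Cmp A Z C X u (i + u) p (d Z C i h) = \<ominus>\<^bsub>G Z X (i + u + u)\<^esub> d Z X (i + u) (Cmp A Z C X u i p h)"
    and "Cmp A Z C Y 0 (i + u) q (d Z C i h) =
      Cmp A Z X Y 0 (i + u) f (Cmp A Z C X u i p h) \<oplus>\<^bsub>G Z Y (i + u)\<^esub> d Z Y i (Cmp A Z C Y 0 i q h)"
proof -
  have "cn_iso K Z (i + u) (d Z C i h) =
      (\<ominus>\<^bsub>G Z X (i + u + u)\<^esub> d Z X (i + u) (fst (cn_iso K Z i h)),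
       Cmp A Z X Y 0 (i + u) f (fst (cn_iso K Z i h)) \<oplus>\<^bsub>G Z Y (i + u)\<^esub> d Z Y i (snd (cn_iso K Z i h)))"
    using K assms by (simp add: is_cone_def complex_iso_def cone_complex_def split_beta)
  then show "Cmp A Z C X u (i + u) p (d Z C i h) = \<ominus>\<^bsub>G Z X (i + u + u)\<^esub> d Z X (i + u) (Cmp A Z C X u i p h)"
    and "Cmp A Z C Y 0 (i + u) q (d Z C i h) =
      Cmp A Z X Y 0 (i + u) f (Cmp A Z C X u i p h) \<oplus>\<^bsub>G Z Y (i + u)\<^esub> d Z Y i (Cmp A Z C Y 0 i q h)"
    using assms by (simp_all add: cn_iso_eq)
qed

lemma cone_inj_simps [simp]:
  "i\<^sub>1 \<in> carrier (G X C (- u))" "Cmp A X C X u (- u) p i\<^sub>1 = Idn A X"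
  "Cmp A X C Y 0 (- u) q i\<^sub>1 = \<zero>\<^bsub>G X Y (- u)\<^esub>"
  "i\<^sub>2 \<in> carrier (G Y C 0)" "Cmp A Y C X u 0 p i\<^sub>2 = \<zero>\<^bsub>G Y X u\<^esub>"
  "Cmp A Y C Y 0 0 q i\<^sub>2 = Idn A Y"
proof -
  have "(Idn A X, \<zero>\<^bsub>G X Y (- u)\<^esub>) \<in> cn_iso K X (- u) ` carrier (G X C (- u))"
    using bij_betw_imp_surj_on[OF cn_iso_bij[OF X, of "- u"]] by simp
  from inv_into_into[OF this] f_inv_into_f[OF this] show mem: "i\<^sub>1 \<in> carrier (G X C (- u))"
    and "Cmp A X C X u (- u) p i\<^sub>1 = Idn A X" "Cmp A X C Y 0 (- u) q i\<^sub>1 = \<zero>\<^bsub>G X Y (- u)\<^esub>"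
    by (auto simp: cone_inj1_def cn_iso_eq)
  have "(\<zero>\<^bsub>G Y X u\<^esub>, Idn A Y) \<in> cn_iso K Y 0 ` carrier (G Y C 0)"
    using bij_betw_imp_surj_on[OF cn_iso_bij[OF Y, of 0]] by simp
  from inv_into_into[OF this] f_inv_into_f[OF this] show mem: "i\<^sub>2 \<in> carrier (G Y C 0)"
    and "Cmp A Y C X u 0 p i\<^sub>2 = \<zero>\<^bsub>G Y X u\<^esub>" "Cmp A Y C Y 0 0 q i\<^sub>2 = Idn A Y"
    by (auto simp: cone_inj2_def cn_iso_eq)
qed

lemma cone_chain [simp]:
  assumes [simp]: "W \<in> Ob A"
  shows "\<lbrakk>x \<in> carrier (G W X k); m = - u + k\<rbrakk> \<Longrightarrow> Cmp A W C X u m p (Cmp A W X C (- u) k i\<^sub>1 x) = x"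
    and "\<lbrakk>x \<in> carrier (G W X k); m = - u + k\<rbrakk> \<Longrightarrow>
      Cmp A W C Y 0 m q (Cmp A W X C (- u) k i\<^sub>1 x) = \<zero>\<^bsub>G W Y (- u + k)\<^esub>"
    and "\<lbrakk>x \<in> carrier (G W Y k); m = k\<rbrakk> \<Longrightarrow>
      Cmp A W C X u m p (Cmp A W Y C 0 k i\<^sub>2 x) = \<zero>\<^bsub>G W X (u + k)\<^esub>"
    and "\<lbrakk>x \<in> carrier (G W Y k); m = k\<rbrakk> \<Longrightarrow> Cmp A W C Y 0 m q (Cmp A W Y C 0 k i\<^sub>2 x) = x"
  by (subst Cmp_chain, auto)+

lemma d_p [simp]: "d C X u p = \<zero>\<^bsub>G C X (u + u)\<^esub>"
proof -
  have "\<ominus>\<^bsub>G C X (u + u)\<^esub> d C X u p = \<zero>\<^bsub>G C X (u + u)\<^esub>"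
    using cn_iso_d(1)[of C "Idn A C" 0] by simp
  then have "\<ominus>\<^bsub>G C X (u + u)\<^esub> (\<ominus>\<^bsub>G C X (u + u)\<^esub> d C X u p) = \<ominus>\<^bsub>G C X (u + u)\<^esub> \<zero>\<^bsub>G C X (u + u)\<^esub>"
    by (rule arg_cong)
  then show ?thesis by simp
qed

lemma d_q [simp]: "d C Y 0 q = \<ominus>\<^bsub>G C Y u\<^esub> Cmp A C X Y 0 u f p"
proof -
  interpret abelian_group "G C Y u" by (simp add: G_abelian)
  have "Cmp A C X Y 0 u f p \<oplus>\<^bsub>G C Y u\<^esub> d C Y 0 q = \<zero>\<^bsub>G C Y u\<^esub>"
    using cn_iso_d(2)[of C "Idn A C" 0] by simp
  then have "d C Y 0 q \<oplus>\<^bsub>G C Y u\<^esub> Cmp A C X Y 0 u f p = \<zero>\<^bsub>G C Y u\<^esub>"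
    by (subst a_comm) simp_all
  then show ?thesis by (metis minus_equality C_Ob X Y f_simps(1) proj_mem d_simps(1) Cmp_mem add_0)
qed

lemma d_inj1 [simp]: "d X C (- u) i\<^sub>1 = Cmp A X Y C 0 0 i\<^sub>2 f"
  by (rule cone_eqI[of X _ 0]) (use cn_iso_d[of X i\<^sub>1 "- u"] in simp_all)

lemma d_inj2 [simp]: "d Y C 0 i\<^sub>2 = \<zero>\<^bsub>G Y C u\<^esub>"
  by (rule cone_eqI[of Y _ u]) (use cn_iso_d[of Y i\<^sub>2 0] in simp_all)

lemma cone_sum: "Cmp A C X C (- u) u i\<^sub>1 p \<oplus>\<^bsub>G C C 0\<^esub> Cmp A C Y C 0 0 i\<^sub>2 q = Idn A C"
  by (rule cone_eqI[of C _ 0]) simp_all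

end

section \<open>The cone of the identity of \<open>X[-1]\<close> is a disk on \<open>X\<close>\<close>

context dg_category
begin

text \<open>
  Composing the structure morphisms of the cone with the isomorphisms \<open>X \<rightarrow> X[-1]\<close> of degree \<open>1\<close> and
  \<open>X[-1] \<rightarrow> X\<close> of degree \<open>-1\<close> preserves all relations between them. The Leibniz rule contributes a
  nonzero term with a sign only where the latter stands on the left of \<open>q\<close>; as \<open>d q = - p\<close> here, this gives \<open>d \<pi>' = \<pi>\<close>.
\<close>

lemma disk_of_cone:
  assumes [simp]: "X \<in> Ob A" and S: "is_shift A X (- u) S"
    and E: "is_cone A (sh_obj S) (sh_obj S) (Idn A (sh_obj S)) E"
  defines "C \<equiv> cn_obj E" and "\<iota> \<equiv> E_iota A X S E" and "\<iota>' \<equiv> E_iota' A X S E"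
    and "\<pi> \<equiv> E_pi A X S E" and "\<pi>' \<equiv> E_pi' A X S E"
  shows "C \<in> Ob A" "\<iota> \<in> carrier (G X C u)" "\<iota>' \<in> carrier (G X C 0)"
    "\<pi> \<in> carrier (G C X 0)" "\<pi>' \<in> carrier (G C X (- u))"
    "d X C 0 \<iota>' = \<iota>" "d X C u \<iota> = \<zero>\<^bsub>G X C (u + u)\<^esub>" "d C X (- u) \<pi>' = \<pi>" "d C X 0 \<pi> = \<zero>\<^bsub>G C X u\<^esub>"
    "Cmp A X C X (- u) 0 \<pi>' \<iota>' = \<zero>\<^bsub>G X X (- u)\<^esub>" "Cmp A X C X 0 u \<pi> \<iota> = \<zero>\<^bsub>G X X u\<^esub>"
    "Cmp A X C X (- u) u \<pi>' \<iota> = Idn A X" "Cmp A X C X 0 0 \<pi> \<iota>' = Idn A X"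
    "Cmp A C X C u (- u) \<iota> \<pi>' \<oplus>\<^bsub>G C C 0\<^esub> Cmp A C X C 0 0 \<iota>' \<pi> = Idn A C"
proof -
  let ?T = "sh_obj S"
  have [simp]: "?T \<in> Ob A" "sh_in S \<in> carrier (G X ?T u)" "d X ?T u (sh_in S) = \<zero>\<^bsub>G X ?T (u + u)\<^esub>"
    "sh_out S \<in> carrier (G ?T X (- u))" "d ?T X (- u) (sh_out S) = \<zero>\<^bsub>G ?T X 0\<^esub>"
    and out_in [simp]: "Cmp A X ?T X (- u) u (sh_out S) (sh_in S) = Idn A X"
    and in_out: "Cmp A ?T X ?T u (- u) (sh_in S) (sh_out S) = Idn A ?T"
    using S by (auto simp: is_shift_def)
  interpret dg_cone A ?T ?T "Idn A ?T" E
    by unfold_locales (use E in simp_all)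
  have [simp]: "Cmp A W X ?T u m (sh_in S) (Cmp A W ?T X (- u) k (sh_out S) x) = x"
    if "W \<in> Ob A" "x \<in> carrier (G W ?T k)" "m = - u + k" for W x k m
    using that by (subst Cmp_chain[OF _ _ _ _ _ in_out]) auto
  note defs = C_def \<iota>_def \<iota>'_def \<pi>_def \<pi>'_def E_iota_def E_iota'_def E_pi_def E_pi'_def
  show "Cmp A C X C u (- u) \<iota> \<pi>' \<oplus>\<^bsub>G C C 0\<^esub> Cmp A C X C 0 0 \<iota>' \<pi> = Idn A C"
  proof -
    interpret abelian_group "G C C 0" by (simp add: G_abelian C_def)
    show ?thesis using cone_sum by (subst a_comm) (simp_all add: defs)
  qed
  show "C \<in> Ob A" "\<iota> \<in> carrier (G X C u)" "\<iota>' \<in> carrier (G X C 0)"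
    "\<pi> \<in> carrier (G C X 0)" "\<pi>' \<in> carrier (G C X (- u))"
    "d X C 0 \<iota>' = \<iota>" "d X C u \<iota> = \<zero>\<^bsub>G X C (u + u)\<^esub>" "d C X (- u) \<pi>' = \<pi>" "d C X 0 \<pi> = \<zero>\<^bsub>G C X u\<^esub>"
    "Cmp A X C X (- u) 0 \<pi>' \<iota>' = \<zero>\<^bsub>G X X (- u)\<^esub>" "Cmp A X C X 0 u \<pi> \<iota> = \<zero>\<^bsub>G X X u\<^esub>"
    "Cmp A X C X (- u) u \<pi>' \<iota> = Idn A X" "Cmp A X C X 0 0 \<pi> \<iota>' = Idn A X"
    by (simp_all add: defs)
qed

end


theorem lemma3p4:
  fixes A :: "('o, 'm, 'g::ab_group_add) dgcat"
    and S :: "'o \<Rightarrow> 'g \<Rightarrow> ('o, 'm) shift"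
    and E :: "'o \<Rightarrow> ('o, 'm, 'g) cone"
  assumes "dg_category A" and "has_shifts A" and "has_cones A"
    and S: "\<And>X i. X \<in> Ob A \<Longrightarrow> is_shift A X i (S X i)"
    and E: "\<And>X. X \<in> Ob A \<Longrightarrow>
      is_cone A (sh_obj (S X (- unit_deg A))) (sh_obj (S X (- unit_deg A)))
        (Idn A (sh_obj (S X (- unit_deg A)))) (E X)"
  shows "\<exists>(\<Phi> :: ('o, 'm, 'o \<times> 'm, 'm) functor_data)
          (\<Psi>p :: ('o \<times> 'm, 'm, 'o, 'm) functor_data)
          (\<Psi>m :: ('o \<times> 'm, 'm, 'o, 'm) functor_data).
      additive_functor (Z0 A) (Z0 (dg_natural A)) \<Phi> \<and>
      faithful (Z0 A) \<Phi> \<and>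
      (\<forall>X\<in>Ob A. FOb \<Phi> X = (cn_obj (E X), E_sigma A X (S X (- unit_deg A)) (E X))) \<and>
      (\<forall>X\<in>Ob A. \<forall>Y\<in>Ob A. \<forall>f\<in>carrier (Mor (Z0 A) X Y).
         FMor \<Phi> X Y f =
           E_map A X (S X (- unit_deg A)) (E X) Y (S Y (- unit_deg A)) (E Y) f) \<and>
      left_adjoint (Z0 (dg_natural A)) (Z0 A) \<Psi>p \<Phi> \<and>
      faithful (Z0 (dg_natural A)) \<Psi>p \<and>
      (\<forall>(X, s)\<in>Ob (dg_natural A). FOb \<Psi>p (X, s) = X) \<and>
      (\<forall>(X, s)\<in>Ob (dg_natural A). \<forall>(Y, t)\<in>Ob (dg_natural A).
         \<forall>f\<in>carrier (Mor (Z0 (dg_natural A)) (X, s) (Y, t)). FMor \<Psi>p (X, s) (Y, t) f = f) \<and>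
      left_adjoint (Z0 A) (Z0 (dg_natural A)) \<Phi> \<Psi>m \<and>
      faithful (Z0 (dg_natural A)) \<Psi>m \<and>
      (\<forall>(X, s)\<in>Ob (dg_natural A). FOb \<Psi>m (X, s) = sh_obj (S X (unit_deg A))) \<and>
      (\<forall>(X, s)\<in>Ob (dg_natural A). \<forall>(Y, t)\<in>Ob (dg_natural A).
         \<forall>f\<in>carrier (Mor (Z0 (dg_natural A)) (X, s) (Y, t)).
           FMor \<Psi>m (X, s) (Y, t) f =
             shift_map A (unit_deg A) X (S X (unit_deg A)) Y (S Y (unit_deg A)) f)"
proof -
  interpret dg_category A by fact
  interpret dg_category_with_disks_and_shift A "\<lambda>X. cn_obj (E X)" "\<lambda>X. E_iota A X (S X (- u)) (E X)"
    "\<lambda>X. E_iota' A X (S X (- u)) (E X)" "\<lambda>X. E_pi A X (S X (- u)) (E X)"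
    "\<lambda>X. E_pi' A X (S X (- u)) (E X)" "\<lambda>X. S X u"
  proof
    show "is_shift A X u (S X u)" if "X \<in> Ob A" for X by (rule S[OF that])
  qed (rule disk_of_cone, assumption, rule S, assumption, rule E, assumption)+
  show ?thesis
    using additive_\<Phi> faithful_\<Phi> \<Psi>p_left_adjoint \<Psi>p_faithful \<Psi>m_right_adjoint \<Psi>m_faithful
    by (intro exI[of _ \<Phi>] exI[of _ \<Psi>p] exI[of _ \<Psi>m] conjI)
      (auto simp: \<Phi>_def \<Psi>p_def \<Psi>m_def disk_homotopy_def E_sigma_def disk_map_def E_map_def)
qed

end
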